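(* For $n\ge 1$ let $P_{n}^{(\mathrm{udr},\mathrm{iudr})}(s,t)=\sum_{\pi\in\mathfrak{S}_{n}}s^{\mathrm{udr}(\pi)}t^{\mathrm{iudr}(\pi)}$. Then, as formal power series, \begin{multline*} \frac{1}{(1-s)(1-t)}+\frac{1}{4(1-s)^{2}(1-t)^{2}}\sum_{n=1}^{\infty}\frac{(1+s^{2})^{n}(1+t^{2})^{n}}{(1-s^{2})^{n-1}(1-t^{2})^{n-1}}P_{n}^{(\mathrm{udr},\mathrm{iudr})}\left(\frac{2s}{1+s^{2}},\frac{2t}{1+t^{2}}\right)x^{n}\\ =\sum_{i,j=0}^{\infty}\left(\frac{1+x}{1-x}\right)^{2ij}\left(1+s\left(\frac{1+x}{1-x}\right)^{j}+t\left(\frac{1+x}{1-x}\right)^{i}+st\frac{(1+x)^{i+j}}{(1-x)^{i+j+1}}\right)s^{2i}t^{2j}. \end{multline*}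
   Context: $\mathfrak{S}_n$ is the symmetric group on $[n]$, and permutations are written in one-line notation $\pi(1)\pi(2)\cdots\pi(n)$. A birun of $\pi$ is a maximal monotone (increasing or decreasing) consecutive subsequence. An up-down run of $\pi$ is either a birun of $\pi$, or the one-element subsequence $\pi(1)$ in the case $\pi(1)>\pi(2)$. $\mathrm{udr}(\pi)$ is the number of up-down runs of $\pi$ (so $\mathrm{udr}=1$ for the unique permutation in $\mathfrak{S}_1$), and $\mathrm{iudr}(\pi)=\mathrm{udr}(\pi^{-1})$. *)

theory Defs
  imports "HOL-Computational_Algebra.Formal_Power_Series" "HOL-Combinatorics.Permutations"
begin

unbundle fps_syntax

text \<open>
  A permutation of \<open>[n]\<close> is a function \<open>\<pi>\<close> with \<open>\<pi> permutes {1..n}\<close>. A consecutive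
  subsequence of the word \<open>\<pi>(1) \<dots> \<pi>(n)\<close> is represented by its nonempty interval of positions.
\<close>

definition monotone_block :: "nat \<Rightarrow> (nat \<Rightarrow> nat) \<Rightarrow> nat set \<Rightarrow> bool" where
  "monotone_block n \<pi> I \<longleftrightarrow>
     (\<exists>i j. 1 \<le> i \<and> i \<le> j \<and> j \<le> n \<and> I = {i..j}) \<and>
     (strict_mono_on I \<pi> \<or> strict_antimono_on I \<pi>)"

definition biruns :: "nat \<Rightarrow> (nat \<Rightarrow> nat) \<Rightarrow> nat set set" where
  "biruns n \<pi> = {I. monotone_block n \<pi> I \<and> (\<forall>J. monotone_block n \<pi> J \<and> I \<subseteq> J \<longrightarrow> J = I)}"

definition up_down_runs :: "nat \<Rightarrow> (nat \<Rightarrow> nat) \<Rightarrow> nat set set" where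
  "up_down_runs n \<pi> = biruns n \<pi> \<union> (if 2 \<le> n \<and> \<pi> 1 > \<pi> 2 then {{1}} else {})"

definition udr :: "nat \<Rightarrow> (nat \<Rightarrow> nat) \<Rightarrow> nat" where
  "udr n \<pi> = card (up_down_runs n \<pi>)"

definition iudr :: "nat \<Rightarrow> (nat \<Rightarrow> nat) \<Rightarrow> nat" where
  "iudr n \<pi> = udr n (inv \<pi>)"

text \<open>The polynomial \<open>P\<^sub>n\<close>, evaluated at elements of an arbitrary commutative ring.\<close>

definition P_udr_iudr :: "nat \<Rightarrow> 'a::comm_ring_1 \<Rightarrow> 'a \<Rightarrow> 'a" where
  "P_udr_iudr n a b = (\<Sum>\<pi> | \<pi> permutes {1..n}. a ^ udr n \<pi> * b ^ iudr n \<pi>)"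

text \<open>
  Formal power series in \<open>s\<close>, \<open>t\<close>, \<open>x\<close> over the rationals, as iterated univariate series:
  \<open>f $ n $ j $ i\<close> is the coefficient of \<open>s\<^sup>i t\<^sup>j x\<^sup>n\<close> in \<open>f\<close>.
\<close>

type_synonym fps_stx = "rat fps fps fps"

definition var_s :: fps_stx where "var_s = fps_const (fps_const fps_X)"
definition var_t :: fps_stx where "var_t = fps_const fps_X"
definition var_x :: fps_stx where "var_x = fps_X"

text \<open>
  The coefficientwise sum of a family of series, meaningful when every monomial occurs in
  only finitely many members. The library topology on an iterated series type treats the
  coefficient ring as discrete, so it is too fine for summing over powers of all the variables.
\<close>

definition formally_summable :: "('b \<Rightarrow> fps_stx) \<Rightarrow> 'b set \<Rightarrow> bool" where
  "formally_summable f A \<longleftrightarrow> (\<forall>n j i. finite {a \<in> A. f a $ n $ j $ i \<noteq> 0})"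

definition formal_sum :: "('b \<Rightarrow> fps_stx) \<Rightarrow> 'b set \<Rightarrow> fps_stx" where
  "formal_sum f A =
     Abs_fps (\<lambda>n. Abs_fps (\<lambda>j. Abs_fps (\<lambda>i. \<Sum>a | a \<in> A \<and> f a $ n $ j $ i \<noteq> 0. f a $ n $ j $ i)))"

text \<open>
  The library division on iterated series is genuine division whenever the
  constant term of the denominator is nonzero.
\<close>

lemma fps_mult_inverse_iterated:
  fixes f :: "'a::{comm_ring_1,inverse} fps"
  assumes "f $ 0 * inverse (f $ 0) = 1"
  shows "f * inverse f = 1"
  using assms by (simp add: fps_inverse_def fps_right_inverse)

lemma fps_stx_divide_mult:
  fixes f g :: fps_stx
  assumes "g $ 0 $ 0 $ 0 \<noteq> 0"
  shows "f / g * g = f"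
proof -
  have "g $ 0 $ 0 * inverse (g $ 0 $ 0) = 1"
    using assms by (simp add: inverse_mult_eq_1')
  then have "g $ 0 * inverse (g $ 0) = 1"
    by (rule fps_mult_inverse_iterated)
  then have *: "g * inverse g = 1"
    by (rule fps_mult_inverse_iterated)
  have "g $ 0 \<noteq> 0"
    using assms by auto
  then have "f / g * g = f * (g * inverse g)"
    by (simp add: fps_divide_unit mult_ac)
  with * show ?thesis by simp
qed

end

theory Submission
  imports Defs
begin

text \<open>
  Label the positions of \<open>\<pi>\<close> weakly increasingly by \<open>1, \<dots>, a\<close>, where an odd label may be repeated
  only across an ascent and an even label only across a descent. Recording the parity of the last
  label, an ascent acts by the rank one matrix \<open>(1, s)\<^sup>T (1, s) / (1 - s\<^sup>2)\<close> and a descent by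
  \<open>(s, 1)\<^sup>T (s, 1) / (1 - s\<^sup>2)\<close>. Hence equal consecutive directions contribute \<open>1 + s\<^sup>2\<close> and
  changes of direction contribute \<open>2 s\<close>, so that the generating function of the labellings depends
  only on \<open>n\<close> and \<open>udr \<pi>\<close>.

  Pairs of labellings of \<open>\<pi>\<close> by \<open>1, \<dots>, a\<close> and of its inverse by \<open>1, \<dots>, b\<close> correspond, by
  standardization, to multisets of \<open>n\<close> cells of an \<open>a\<close> by \<open>b\<close> checkerboard in which black cells
  are used at most once. White cells contribute \<open>1 / (1 - x)\<close> and black cells \<open>1 + x\<close>, which gives
  the coefficient of \<open>s\<^sup>a t\<^sup>b\<close> on the right-hand side.
\<close>

subsection \<open>Chains with repeatable elements\<close>

definition rel_chains :: "nat \<Rightarrow> 'a set \<Rightarrow> (nat \<Rightarrow> 'a \<Rightarrow> 'a \<Rightarrow> bool) \<Rightarrow> (nat \<Rightarrow> 'a) set" where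
  "rel_chains n A R = {p \<in> {1..n} \<rightarrow>\<^sub>E A. \<forall>k\<in>{1..<n}. R k (p k) (p (Suc k))}"

lemma finite_rel_chains: "finite A \<Longrightarrow> finite (rel_chains n A R)"
  unfolding rel_chains_def by (rule finite_subset[OF _ finite_PiE[of "{1..n}" "\<lambda>_. A"]]) auto

lemma rel_chains_0: "rel_chains 0 A R = {\<lambda>_. undefined}"
  by (auto simp: rel_chains_def)

lemma rel_chains_Suc_empty: "rel_chains (Suc n) {} R = {}"
  unfolding rel_chains_def using PiE_mem[of _ "{1..Suc n}" "\<lambda>_. {}" 1] by auto

text \<open>Deleting the last entry, that is resetting it to \<open>undefined\<close>, is undone by
  writing \<open>q\<close> back. The guard \<open>1 \<le> n\<close> is there because a chain of
  length one has no step into its last entry.\<close>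

lemma card_rel_chains_last:
  assumes "q \<in> A"
  shows "card {p \<in> rel_chains (Suc n) A R. p (Suc n) = q} =
    card {p \<in> rel_chains n A R. 1 \<le> n \<longrightarrow> R n (p n) q}"
proof (rule bij_betw_same_card[OF bij_betw_byWitness[where f = "\<lambda>p. p(Suc n := undefined)"
      and f' = "\<lambda>p. p(Suc n := q)"]])
  show "\<forall>p\<in>{p \<in> rel_chains (Suc n) A R. p (Suc n) = q}. (p(Suc n := undefined))(Suc n := q) = p"
    by auto
  show "\<forall>p\<in>{p \<in> rel_chains n A R. 1 \<le> n \<longrightarrow> R n (p n) q}. (p(Suc n := q))(Suc n := undefined) = p"
    by (auto simp: rel_chains_def PiE_def extensional_def fun_eq_iff)
  show "(\<lambda>p. p(Suc n := undefined)) ` {p \<in> rel_chains (Suc n) A R. p (Suc n) = q}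
      \<subseteq> {p \<in> rel_chains n A R. 1 \<le> n \<longrightarrow> R n (p n) q}"
    by (auto simp: rel_chains_def PiE_def extensional_def Pi_def)
  show "(\<lambda>p. p(Suc n := q)) ` {p \<in> rel_chains n A R. 1 \<le> n \<longrightarrow> R n (p n) q}
      \<subseteq> {p \<in> rel_chains (Suc n) A R. p (Suc n) = q}"
    using assms by (auto simp: rel_chains_def PiE_def extensional_def Pi_def less_Suc_eq le_Suc_eq)
qed

lemma rel_chains_mono_key:
  fixes key :: "'a \<Rightarrow> nat"
  assumes p: "p \<in> rel_chains n A R" and R: "\<And>k x y. R k x y \<Longrightarrow> key x \<le> key y"
    and kl: "1 \<le> k" "k \<le> l" "l \<le> n"
  shows "key (p k) \<le> key (p l)"
  using kl(2,3)
proof (induction l rule: dec_induct)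
  case (step m)
  then have "R m (p m) (p (Suc m))"
    using p kl(1) by (auto simp: rel_chains_def)
  then show ?case
    using step R[of m] by fastforce
qed simp

text \<open>Keys weakly increase along a chain, so a chain that meets the element \<open>q\<close>
  of strictly largest key can never leave it. Avoiding \<open>q\<close> at the last position
  therefore means avoiding it everywhere.\<close>

lemma rel_chains_insert_max:
  fixes key :: "'a \<Rightarrow> nat"
  assumes R: "\<And>k x y. R k x y \<Longrightarrow> key x \<le> key y" and q: "\<And>x. x \<in> A \<Longrightarrow> key x < key q"
  shows "{p \<in> rel_chains n (insert q A) R. 1 \<le> n \<longrightarrow> p n \<noteq> q} = rel_chains n A R"
proof (intro equalityI subsetI)
  fix p assume "p \<in> {p \<in> rel_chains n (insert q A) R. 1 \<le> n \<longrightarrow> p n \<noteq> q}"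
  then have p: "p \<in> rel_chains n (insert q A) R" and n: "1 \<le> n \<longrightarrow> p n \<noteq> q"
    by auto
  have "p k \<in> A" if k: "k \<in> {1..n}" for k
  proof -
    have "p n \<in> insert q A" "p k \<in> insert q A"
      using p k by (auto simp: rel_chains_def PiE_def Pi_def)
    moreover have "key (p k) \<le> key (p n)"
      by (rule rel_chains_mono_key[where R = R, OF p]) (use R k in auto)
    ultimately show ?thesis
      using n k q[of "p n"] by auto
  qed
  with p show "p \<in> rel_chains n A R"
    by (auto simp: rel_chains_def PiE_def Pi_def)
next
  fix p assume "p \<in> rel_chains n A R"
  then show "p \<in> {p \<in> rel_chains n (insert q A) R. 1 \<le> n \<longrightarrow> p n \<noteq> q}"
    using q by (fastforce simp: rel_chains_def PiE_def Pi_def)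
qed

text \<open>A chain is a multiset on \<open>A\<close> listed by increasing key, with arbitrary
  multiplicity for white elements and multiplicity at most one for the others. The induction removes
  the element of largest key.\<close>

lemma rel_chains_gf:
  fixes key :: "'a \<Rightarrow> nat"
  assumes "finite A" "inj_on key A"
  shows "Abs_fps (\<lambda>n. of_nat (card (rel_chains n A (\<lambda>_ x y. key x < key y \<or> x = y \<and> white x)))) =
    (\<Prod>x\<in>A. if white x then inverse (1 - fps_X) else 1 + fps_X :: rat fps)"
  using assms
proof (induction "card A" arbitrary: A)
  case 0
  then have "card (rel_chains n A (\<lambda>_ x y. key x < key y \<or> x = y \<and> white x)) = (if n = 0 then 1 else 0)" for n
    by (cases n) (simp_all add: rel_chains_0 rel_chains_Suc_empty)
  then show ?case
    using 0 by (auto simp: fps_eq_iff)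
next
  case (Suc N)
  define R where "R = (\<lambda>(_::nat) x y. key x < key y \<or> x = y \<and> white x)"
  have Rkey: "key x \<le> key y" if "R k x y" for k x y
    using that by (auto simp: R_def)
  have "A \<noteq> {}"
    using Suc by auto
  then obtain q where q: "q \<in> A" "\<And>x. x \<in> A \<Longrightarrow> key x \<le> key q"
    using Suc.prems(1) Max_in[of "key ` A"] Max_ge[of "key ` A"] by (metis (no_types, lifting) finite_imageI image_iff image_is_empty)
  define B where "B = A - {q}"
  have A: "A = insert q B" "q \<notin> B" "finite B"
    using q Suc.prems by (auto simp: B_def)
  have qB: "key x < key q" if "x \<in> B" for x
    using that q Suc.prems(2) by (metis B_def DiffE inj_on_contraD insertCI order_less_le)
  let ?c = "\<lambda>A n. card (rel_chains n A R)"
  have ins: "{p \<in> rel_chains n A R. 1 \<le> n \<longrightarrow> p n \<noteq> q} = rel_chains n B R" for n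
    unfolding A(1) by (rule rel_chains_insert_max[where R = R and key = key]) (use Rkey qB in auto)
  \<comment> \<open>Split by the last entry. Chains not ending in \<open>q\<close> live in
    \<open>B\<close>; the others extend a chain of length \<open>n\<close> by \<open>q\<close>, and
    that chain may itself end in \<open>q\<close> only if \<open>q\<close> is white.\<close>
  have step: "?c A (Suc n) = ?c B (Suc n) + (if white q then ?c A n else ?c B n)" for n
  proof -
    have "rel_chains (Suc n) A R = {p \<in> rel_chains (Suc n) A R. 1 \<le> Suc n \<longrightarrow> p (Suc n) \<noteq> q}
        \<union> {p \<in> rel_chains (Suc n) A R. p (Suc n) = q}"
      by auto
    then have "?c A (Suc n) = ?c B (Suc n) + card {p \<in> rel_chains (Suc n) A R. p (Suc n) = q}"
      using finite_rel_chains[OF Suc.prems(1), of "Suc n" R]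
      by (subst ins[symmetric], subst card_Un_disjoint[symmetric]) auto
    also have "card {p \<in> rel_chains (Suc n) A R. p (Suc n) = q}
        = card {p \<in> rel_chains n A R. 1 \<le> n \<longrightarrow> R n (p n) q}"
      by (rule card_rel_chains_last) fact
    also have "{p \<in> rel_chains n A R. 1 \<le> n \<longrightarrow> R n (p n) q}
        = (if white q then rel_chains n A R else {p \<in> rel_chains n A R. 1 \<le> n \<longrightarrow> p n \<noteq> q})"
    proof -
      have "R n x q \<longleftrightarrow> white q \<or> x \<noteq> q" if "x \<in> A" for x
        using that qB by (auto simp: R_def A(1))
      moreover have "p n \<in> A" if "p \<in> rel_chains n A R" "1 \<le> n" for p
        using that by (auto simp: rel_chains_def PiE_def Pi_def)
      ultimately show ?thesis
        by auto
    qed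
    finally show ?thesis
      unfolding ins by simp
  qed
  let ?g = "\<lambda>A. Abs_fps (\<lambda>n. of_nat (?c A n)) :: rat fps"
  let ?w = "if white q then inverse (1 - fps_X) else 1 + fps_X :: rat fps"
  have unit: "inverse (1 - fps_X :: rat fps) * (1 - fps_X) = 1"
    by (rule inverse_mult_eq_1) simp
  have "?g A = ?w * ?g B"
  proof (cases "white q")
    case True
    \<comment> \<open>The recurrence as an equation of series; solving it gives the geometric
      factor. In the other case the second summand involves \<open>B\<close>, which gives the factor
      1 + x at once.\<close>
    have "?g A = ?g B + fps_X * ?g A"
    proof (rule fps_ext)
      fix n show "?g A $ n = (?g B + fps_X * ?g A) $ n"
        using True by (cases n) (simp_all add: rel_chains_0 step)
    qed
    then have "?g B = (1 - fps_X) * ?g A"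
      by (simp add: algebra_simps)
    then have "?w * ?g B = (inverse (1 - fps_X) * (1 - fps_X)) * ?g A"
      using True by (simp only: if_True mult.assoc)
    then show ?thesis
      unfolding unit by simp
  next
    case False
    have "?g A = ?g B + fps_X * ?g B"
    proof (rule fps_ext)
      fix n show "?g A $ n = (?g B + fps_X * ?g B) $ n"
        using False by (cases n) (simp_all add: rel_chains_0 step)
    qed
    with False show ?thesis
      by (simp add: algebra_simps)
  qed
  moreover have "?g B = (\<Prod>x\<in>B. if white x then inverse (1 - fps_X) else 1 + fps_X)"
    unfolding R_def using Suc A by (intro Suc.hyps(1)) (auto simp: inj_on_def)
  ultimately show ?case
    using A by (simp add: R_def)
qed

subsection \<open>Labellings compatible with a sequence of directions\<close>

text \<open>Position 0 counts as an ascent, so that an initial descent is a change of direction: it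
  accounts for the extra up-down run \<open>\<pi>(1)\<close>.\<close>

definition ascent :: "(nat \<Rightarrow> nat) \<Rightarrow> nat \<Rightarrow> bool" where
  "ascent \<pi> k \<longleftrightarrow> k = 0 \<or> \<pi> k < \<pi> (Suc k)"

definition labellings :: "nat \<Rightarrow> nat \<Rightarrow> (nat \<Rightarrow> bool) \<Rightarrow> (nat \<Rightarrow> nat) set" where
  "labellings a n d = rel_chains n {1..a} (\<lambda>k x y. x < y \<or> x = y \<and> (odd x \<longleftrightarrow> d k))"

text \<open>\<open>last_count d n l\<close> counts the labellings of \<open>n + 1\<close> positions whose last label is \<open>l\<close>; note
  the shift by one.\<close>

primrec last_count :: "(nat \<Rightarrow> bool) \<Rightarrow> nat \<Rightarrow> nat \<Rightarrow> nat" where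
  "last_count d 0 l = (if l = 0 then 0 else 1)"
| "last_count d (Suc n) l = (\<Sum>m<l. last_count d n m) + (if odd l \<longleftrightarrow> d (Suc n) then last_count d n l else 0)"

text \<open>Label 0 never occurs; giving it count 0 lets sums over labels start at 0 instead of
  1.\<close>

lemma last_count_0_right [simp]: "last_count d n 0 = 0"
  by (induction n) auto

text \<open>Labels weakly increase, so with last label \<open>l\<close> only labels up to
  \<open>l\<close> occur; this is why the count does not depend on the bound
  \<open>a\<close>.\<close>

lemma card_labellings_last:
  assumes "l \<in> {1..a}"
  shows "card {u \<in> labellings a (Suc n) d. u (Suc n) = l} = last_count d n l"
  using assms
proof (induction n arbitrary: l)
  case 0
  then have "card {u \<in> labellings a (Suc 0) d. u (Suc 0) = l} = 1"
    unfolding labellings_def by (simp only: card_rel_chains_last) (simp add: rel_chains_0)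
  then show ?case
    using 0 by simp
next
  case (Suc n)
  let ?S = "\<lambda>m. {u \<in> labellings a (Suc n) d. u (Suc n) = m}"
  let ?M = "{1..<l} \<union> (if odd l \<longleftrightarrow> d (Suc n) then {l} else {})"
  have ran: "u (Suc n) \<in> {1..a}" if "u \<in> labellings a (Suc n) d" for u
    using that by (auto simp: labellings_def rel_chains_def PiE_def Pi_def)
  have fin: "finite (labellings a (Suc n) d)"
    unfolding labellings_def by (rule finite_rel_chains) simp
  have "card {u \<in> labellings a (Suc (Suc n)) d. u (Suc (Suc n)) = l} =
      card {u \<in> labellings a (Suc n) d. u (Suc n) < l \<or> u (Suc n) = l \<and> (odd (u (Suc n)) \<longleftrightarrow> d (Suc n))}"
    unfolding labellings_def using Suc.prems by (subst card_rel_chains_last) simp_all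
  also have "{u \<in> labellings a (Suc n) d. u (Suc n) < l \<or> u (Suc n) = l \<and> (odd (u (Suc n)) \<longleftrightarrow> d (Suc n))}
      = (\<Union>m\<in>?M. ?S m)"
  proof (intro equalityI subsetI)
    fix u assume "u \<in> {u \<in> labellings a (Suc n) d. u (Suc n) < l \<or> u (Suc n) = l \<and> (odd (u (Suc n)) \<longleftrightarrow> d (Suc n))}"
    with ran[of u] have "u \<in> labellings a (Suc n) d" "u (Suc n) \<in> ?M"
      by auto
    then show "u \<in> (\<Union>m\<in>?M. ?S m)"
      by blast
  qed (auto split: if_splits)
  also have "card \<dots> = (\<Sum>m\<in>?M. card (?S m))"
    using fin by (subst card_UN_disjoint) auto
  also have "\<dots> = (\<Sum>m\<in>?M. last_count d n m)"
    using Suc.prems by (intro sum.cong refl Suc.IH) (auto split: if_splits)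
  also have "\<dots> = (\<Sum>m\<in>{1..<l}. last_count d n m) + (if odd l \<longleftrightarrow> d (Suc n) then last_count d n l else 0)"
    by (subst sum.union_disjoint) auto
  also have "(\<Sum>m\<in>{1..<l}. last_count d n m) = (\<Sum>m<l. last_count d n m)"
    by (rule sum.mono_neutral_left) (auto simp: not_less_eq_eq)
  finally show ?case
    by simp
qed

lemma card_labellings:
  "card (labellings a (Suc n) d) = (\<Sum>l\<le>a. last_count d n l)"
proof -
  let ?S = "\<lambda>m. {u \<in> labellings a (Suc n) d. u (Suc n) = m}"
  have fin: "finite (labellings a (Suc n) d)"
    unfolding labellings_def by (rule finite_rel_chains) simp
  have "labellings a (Suc n) d = (\<Union>m\<in>{1..a}. ?S m)"
    by (auto simp: labellings_def rel_chains_def PiE_def Pi_def)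
  then have "card (labellings a (Suc n) d) = card (\<Union>m\<in>{1..a}. ?S m)"
    by simp
  also have "\<dots> = (\<Sum>m\<in>{1..a}. card (?S m))"
    using fin by (subst card_UN_disjoint) auto
  also have "\<dots> = (\<Sum>m\<in>{1..a}. last_count d n m)"
    by (intro sum.cong refl card_labellings_last)
  also have "\<dots> = (\<Sum>m\<le>a. last_count d n m)"
    by (rule sum.mono_neutral_left) (auto simp: not_less_eq_eq)
  finally show ?thesis .
qed

section \<open>Generating function of the labellings for a fixed sequence of directions\<close>

definition changes :: "(nat \<Rightarrow> bool) \<Rightarrow> nat \<Rightarrow> nat" where
  "changes d n = card {k \<in> {1..n}. d k \<noteq> d (k - 1)}"

lemma changes_0 [simp]: "changes d 0 = 0"
  by (simp add: changes_def)

lemma changes_Suc: "changes d (Suc n) = changes d n + (if d (Suc n) \<noteq> d n then 1 else 0)"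
proof -
  have "{k \<in> {1..Suc n}. d k \<noteq> d (k - 1)} =
      {k \<in> {1..n}. d k \<noteq> d (k - 1)} \<union> (if d (Suc n) \<noteq> d n then {Suc n} else {})"
    by (auto simp: le_Suc_eq)
  then show ?thesis
    unfolding changes_def by (simp add: card_insert_if)
qed

lemma changes_le: "changes d n \<le> n"
  by (induction n) (auto simp: changes_Suc)

text \<open>The odd (\<open>True\<close>) and even (\<open>False\<close>) parts are kept apart
  because the parity of a label decides at which steps it may be repeated.\<close>

definition parity_gf :: "(nat \<Rightarrow> nat) \<Rightarrow> bool \<Rightarrow> rat fps" where
  "parity_gf f b = Abs_fps (\<lambda>l. if odd l = b then of_nat (f l) else 0)"

lemma mult_one_minus_X2_nth:
  "((1 - fps_X\<^sup>2) * f :: rat fps) $ l = f $ l - (if l < 2 then 0 else f $ (l - 2))"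
  by (simp add: left_diff_distrib fps_X_power_mult_nth)

text \<open>These are the entries of the rank one transfer matrices, with the denominator cleared.
  Multiplying by 1 - s^2 subtracts the coefficient at l - 2 from that at l, two labels of equal
  parity, so the sums over smaller labels collapse to the terms at l - 1 and l - 2, and repetition
  shifts l - 2 to l.\<close>

lemma parity_gf_step:
  fixes d :: "nat \<Rightarrow> bool"
  defines "g \<equiv> \<lambda>n. parity_gf (last_count d n)"
  shows "(1 - fps_X\<^sup>2) * g (Suc n) True =
      (if d (Suc n) then g n True else fps_X\<^sup>2 * g n True) + fps_X * g n False" (is ?t1)
    and "(1 - fps_X\<^sup>2) * g (Suc n) False =
      (if d (Suc n) then fps_X\<^sup>2 * g n False else g n False) + fps_X * g n True" (is ?t2)
proof -
  have X2: "fps_X\<^sup>2 * f = fps_X * (fps_X * f)" for f :: "rat fps"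
    by (simp add: power2_eq_square mult.assoc)
  have cases3: "P m" if "P 0" "P (Suc 0)" "\<And>l. P (Suc (Suc l))" for P and m :: nat
    using that by (cases m; cases "m - 1") auto
  show ?t1
  proof (rule fps_ext)
    fix l show "((1 - fps_X\<^sup>2) * g (Suc n) True) $ l = ((if d (Suc n) then g n True else fps_X\<^sup>2 * g n True) + fps_X * g n False) $ l"
      unfolding mult_one_minus_X2_nth
      by (rule cases3[of _ l]) (auto simp: g_def parity_gf_def X2)
  qed
  show ?t2
  proof (rule fps_ext)
    fix l show "((1 - fps_X\<^sup>2) * g (Suc n) False) $ l = ((if d (Suc n) then fps_X\<^sup>2 * g n False else g n False) + fps_X * g n True) $ l"
      unfolding mult_one_minus_X2_nth
      by (rule cases3[of _ l]) (auto simp: g_def parity_gf_def X2)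
  qed
qed

text \<open>The pair of parity parts stays a multiple of (1, s), with the 1 at the parity matching
  the last direction. The next step multiplies it by 1 + s * s if the direction persists and by s +
  s if it changes. A single position gives s (1, s) / (1 - s^2), the pattern of an ascent, whence
  the assumption \<open>d 0\<close>.\<close>

lemma parity_gf_closed:
  assumes "d 0"
  shows "(1 - fps_X\<^sup>2) ^ Suc n * parity_gf (last_count d n) b =
    fps_X * (1 + fps_X\<^sup>2) ^ (n - changes d n) * (2 * fps_X) ^ changes d n
      * (if b = d n then 1 else fps_X)"
proof (induction n arbitrary: b)
  case 0
  show ?case
  proof (rule fps_ext)
    fix l
    have cases4: "P m" if "P 0" "P (Suc 0)" "P (Suc (Suc 0))" "\<And>l. P (Suc (Suc (Suc l)))" for P and m :: nat
      using that by (cases m; cases "m - 1"; cases "m - 2") auto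
    show "((1 - fps_X\<^sup>2) ^ Suc 0 * parity_gf (last_count d 0) b) $ l = (fps_X * (1 + fps_X\<^sup>2) ^ (0 - changes d 0)
      * (2 * fps_X) ^ changes d 0 * (if b = d 0 then 1 else fps_X)) $ l"
      unfolding power_Suc power_0 mult_1_right mult_one_minus_X2_nth
      by (rule cases4[of _ l]) (auto simp: parity_gf_def assms)
  qed
next
  case (Suc n)
  let ?D = "1 - fps_X\<^sup>2 :: rat fps" and ?g = "parity_gf (last_count d n)"
  have IH: "?D ^ Suc n * ?g b = fps_X * (1 + fps_X\<^sup>2) ^ (n - changes d n) * (2 * fps_X) ^ changes d n
      * (if b = d n then 1 else fps_X)" for b
    by (rule Suc.IH)
  have le: "changes d n \<le> n"
    by (rule changes_le)
  have step: "?D ^ Suc (Suc n) * parity_gf (last_count d (Suc n)) b =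
     (if b = d (Suc n) then 1 else fps_X\<^sup>2) * (?D ^ Suc n * ?g b) + fps_X * (?D ^ Suc n * ?g (\<not> b))"
  proof -
    have "?D ^ Suc (Suc n) * parity_gf (last_count d (Suc n)) b = ?D ^ Suc n * (?D * parity_gf (last_count d (Suc n)) b)"
      by (simp add: mult_ac)
    also have "?D * parity_gf (last_count d (Suc n)) b = (if b = d (Suc n) then 1 else fps_X\<^sup>2) * ?g b + fps_X * ?g (\<not> b)"
      using parity_gf_step[of d n] by (cases b) auto
    finally show ?thesis
      by (simp add: distrib_left mult_ac del: last_count.simps)
  qed
  show ?case
  proof -
    define K :: "rat fps" where
      "K = fps_X * (1 + fps_X\<^sup>2) ^ (n - changes d n) * (2 * fps_X) ^ changes d n"
    have lhs: "?D ^ Suc (Suc n) * parity_gf (last_count d (Suc n)) b =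
        (if b = d (Suc n) then 1 else fps_X\<^sup>2) * (K * (if b = d n then 1 else fps_X))
          + fps_X * (K * (if b = d n then fps_X else 1))"
      unfolding step IH K_def by auto
    have rhs: "fps_X * (1 + fps_X\<^sup>2) ^ (Suc n - changes d (Suc n)) * (2 * fps_X) ^ changes d (Suc n)
        = (if d (Suc n) = d n then 1 + fps_X\<^sup>2 else 2 * fps_X) * K"
      unfolding changes_Suc K_def using le by (simp add: Suc_diff_le mult_ac)
    show ?thesis
      unfolding lhs rhs
      by (cases "b = d (Suc n)"; cases "b = d n") (auto simp: algebra_simps power2_eq_square)
  qed
qed

text \<open>Summing over the last label divides by 1 - s, and adding the two parity parts gives a
  factor 1 + s, which cancels against one factor 1 - s^2. The 2 on the left turns the leftover s of
  the first position into one more 2 s, so that the exponent becomes the number of up-down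
  runs.\<close>

lemma labellings_gf:
  assumes "d 0" and n: "1 \<le> n"
  shows "2 * (1 - fps_X)\<^sup>2 * (1 - fps_X\<^sup>2) ^ (n - 1) * Abs_fps (\<lambda>a. of_nat (card (labellings a n d))) =
    (1 + fps_X\<^sup>2) ^ (n - Suc (changes d (n - 1))) * (2 * fps_X :: rat fps) ^ Suc (changes d (n - 1))"
proof -
  obtain m where m: "n = Suc m"
    using n by (cases n) auto
  let ?G = "Abs_fps (\<lambda>a. of_nat (card (labellings a n d))) :: rat fps"
  let ?C = "(1 + fps_X\<^sup>2) ^ (m - changes d m) * (2 * fps_X :: rat fps) ^ changes d m"
  have G: "(1 - fps_X) * ?G = parity_gf (last_count d m) True + parity_gf (last_count d m) False"
  proof (rule fps_ext)
    fix l show "((1 - fps_X) * ?G) $ l = (parity_gf (last_count d m) True + parity_gf (last_count d m) False) $ l"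
      by (cases l) (simp_all add: left_diff_distrib m card_labellings parity_gf_def)
  qed
  \<comment> \<open>Both sides carry the factor 1 + s, so that 1 - s^2 is complete on the left; it
    is cancelled afterwards as a nonzero series.\<close>
  have "(1 + fps_X) * ((1 - fps_X)\<^sup>2 * (1 - fps_X\<^sup>2) ^ m * ?G) = (1 - fps_X\<^sup>2) ^ Suc m * ((1 - fps_X) * ?G)"
    by (simp add: algebra_simps power2_eq_square)
  also have "\<dots> = (1 + fps_X) * (fps_X * ?C)"
    unfolding G distrib_left parity_gf_closed[of d, OF assms(1)]
    by (auto simp: algebra_simps)
  finally have "(1 - fps_X)\<^sup>2 * (1 - fps_X\<^sup>2) ^ m * ?G = fps_X * ?C"
  proof -
    have "(1 + fps_X :: rat fps) $ 0 \<noteq> 0" by simp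
    then have "(1 + fps_X :: rat fps) \<noteq> 0" by (metis fps_zero_nth)
    then show "(1 + fps_X) * ((1 - fps_X)\<^sup>2 * (1 - fps_X\<^sup>2) ^ m * ?G) = (1 + fps_X) * (fps_X * ?C) \<Longrightarrow> ?thesis"
      by simp
  qed
  then show ?thesis
    by (simp add: m algebra_simps)
qed

subsection \<open>Up-down runs and changes of direction\<close>

lemma mono_block_up:
  assumes "1 \<le> i"
  shows "strict_mono_on {i..j} \<pi> \<longleftrightarrow> (\<forall>k\<in>{i..<j}. ascent \<pi> k)"
proof
  assume d: "\<forall>k\<in>{i..<j}. ascent \<pi> k"
  have "\<pi> k < \<pi> l" if "i \<le> k" "Suc k \<le> l" "l \<le> j" for k l
    using that(2,3)
  proof (induction l rule: dec_induct)
    case base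
    then show ?case
      using d assms that by (auto simp: ascent_def)
  next
    case (step l)
    then show ?case
      using d[rule_format, of l] assms that by (auto simp: ascent_def)
  qed
  then show "strict_mono_on {i..j} \<pi>"
    by (auto simp: strict_mono_on_def)
qed (auto simp: ascent_def strict_mono_on_def)

lemma mono_block_down:
  assumes "1 \<le> i" "j \<le> n" "inj_on \<pi> {1..n}"
  shows "strict_antimono_on {i..j} \<pi> \<longleftrightarrow> (\<forall>k\<in>{i..<j}. \<not> ascent \<pi> k)"
proof
  assume d: "\<forall>k\<in>{i..<j}. \<not> ascent \<pi> k"
  \<comment> \<open>A failed ascent gives only a weak inequality; injectivity makes it
    strict.\<close>
  have st: "\<pi> (Suc k) < \<pi> k" if "k \<in> {i..<j}" for k
  proof -
    have "\<pi> (Suc k) \<noteq> \<pi> k"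
      using that assms inj_onD[OF assms(3), of "Suc k" k] by auto
    then show ?thesis
      using d[rule_format, OF that] by (auto simp: ascent_def)
  qed
  have "\<pi> k > \<pi> l" if "i \<le> k" "Suc k \<le> l" "l \<le> j" for k l
    using that(2,3)
  proof (induction l rule: dec_induct)
    case base
    then show ?case
      using st[of k] assms that by auto
  next
    case (step l)
    then show ?case
      using st[of l] assms that by auto
  qed
  then show "strict_antimono_on {i..j} \<pi>"
    by (auto simp: monotone_on_def)
next
  assume "strict_antimono_on {i..j} \<pi>"
  then have "\<pi> (Suc k) < \<pi> k" if "k \<in> {i..<j}" for k
    using that by (auto simp: monotone_on_def)
  then show "\<forall>k\<in>{i..<j}. \<not> ascent \<pi> k"
    using assms(1) by (fastforce simp: ascent_def)
qed

lemma monotone_block_iff: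
  assumes "inj_on \<pi> {1..n}"
  shows "monotone_block n \<pi> I \<longleftrightarrow>
    (\<exists>i j e. 1 \<le> i \<and> i \<le> j \<and> j \<le> n \<and> I = {i..j} \<and> (\<forall>k\<in>{i..<j}. ascent \<pi> k = e))"
proof -
  have "strict_mono_on {i..j} \<pi> \<or> strict_antimono_on {i..j} \<pi> \<longleftrightarrow> (\<exists>e. \<forall>k\<in>{i..<j}. ascent \<pi> k = e)"
    if "1 \<le> i" "j \<le> n" for i j
    unfolding mono_block_up[OF that(1)] mono_block_down[OF that assms] ex_bool_eq by simp
  then have "(1 \<le> i \<and> i \<le> j \<and> j \<le> n \<and> I = {i..j}) \<and> (strict_mono_on I \<pi> \<or> strict_antimono_on I \<pi>) \<longleftrightarrow>
      (\<exists>e. 1 \<le> i \<and> i \<le> j \<and> j \<le> n \<and> I = {i..j} \<and> (\<forall>k\<in>{i..<j}. ascent \<pi> k = e))" for i j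
    by auto
  then show ?thesis
    unfolding monotone_block_def by (simp only: ex_simps(1)[symmetric])
qed

text \<open>A birun is determined by its first position, which is either 1 or a turning point shared
  with the preceding birun. As \<open>2 \<le> n\<close>, every birun contains at least two
  positions, so it starts before \<open>n\<close>.\<close>

lemma bij_betw_biruns_left_end:
  assumes inj: "inj_on \<pi> {1..n}" and n: "2 \<le> n"
  shows "bij_betw Min (biruns n \<pi>) {k \<in> {1..<n}. k = 1 \<or> ascent \<pi> k \<noteq> ascent \<pi> (k - 1)}"
  unfolding bij_betw_def
proof (intro conjI equalityI)
  note mb = monotone_block_iff[OF inj]
  let ?d = "ascent \<pi>"
  have mbI: "monotone_block n \<pi> {i..j}" if "1 \<le> i" "i \<le> j" "j \<le> n" "\<And>k. k \<in> {i..<j} \<Longrightarrow> ?d k = e" for i j e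
    unfolding mb by (intro exI[of _ i] exI[of _ j] exI[of _ e] conjI ballI refl) fact+
  have block: "\<exists>j. i < j \<and> j \<le> n \<and> 1 \<le> i \<and> I = {i..j} \<and> (i = 1 \<or> ?d i \<noteq> ?d (i - 1))"
    if I: "I \<in> biruns n \<pi>" and i: "i = Min I" for I i
  proof -
    have max: "\<And>J. monotone_block n \<pi> J \<Longrightarrow> I \<subseteq> J \<Longrightarrow> J = I" and bl: "monotone_block n \<pi> I"
      using I by (auto simp: biruns_def)
    obtain i' j e where j: "1 \<le> i'" "i' \<le> j" "j \<le> n" "I = {i'..j}"
      and e: "\<And>k. k \<in> {i'..<j} \<Longrightarrow> ?d k = e"
      using bl unfolding mb by blast
    have "Min {i'..j} = i'"
      using j by (intro Min_eqI) auto
    then have "i' = i"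
      using i j by simp
    note j = j[unfolded this] and e = e[unfolded this]
    \<comment> \<open>A singleton is not maximal: two adjacent positions always form a monotone
      block, so it extends to the right, or to the left if it is the last position.\<close>
    have "i < j"
    proof (rule ccontr)
      assume "\<not> i < j"
      then have I': "I = {i}"
        using j by auto
      show False
      proof (cases "i < n")
        case True
        have "monotone_block n \<pi> {i..Suc i}"
          by (rule mbI[where e = "?d i"]) (use j True in auto)
        from max[OF this] have "Suc i \<in> {i}"
          unfolding I' by auto
        then show False
          by simp
      next
        case False
        have "k = i - 1" if "k \<in> {i - 1..<i}" for k
          using that by auto
        then have "monotone_block n \<pi> {i - 1..i}"
          using j n False by (intro mbI[where e = "?d (i - 1)"]) auto
        from max[OF this] have "i - 1 \<in> {i}"
          unfolding I' by auto
        then show False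
          using j by auto
      qed
    qed
    \<comment> \<open>Otherwise the step into \<open>i\<close> has the same direction and the block
      extends to the left.\<close>
    moreover have "i = 1 \<or> ?d i \<noteq> ?d (i - 1)"
    proof (rule ccontr)
      assume c: "\<not> (i = 1 \<or> ?d i \<noteq> ?d (i - 1))"
      have "?d k = e" if "k \<in> {i - 1..<j}" for k
      proof -
        have "k = i - 1 \<or> k \<in> {i..<j}"
          using that by auto
        then show ?thesis
          using c e[of i] e[of k] \<open>i < j\<close> by auto
      qed
      then have "monotone_block n \<pi> {i - 1..j}"
        using c j by (intro mbI[where e = e]) auto
      from max[OF this] have "i - 1 \<in> {i..j}"
        using j by auto
      then show False
        using c j by auto
    qed
    ultimately show ?thesis
      using j by (intro exI[of _ j] conjI)
  qed
  show "inj_on Min (biruns n \<pi>)"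
  proof (rule inj_onI)
    fix I J assume I: "I \<in> biruns n \<pi>" and J: "J \<in> biruns n \<pi>" and eq: "Min I = Min J"
    obtain m j j' where "I = {m..j}" "J = {m..j'}"
      using block[OF I refl] block[OF J eq] by blast
    then have "I \<subseteq> J \<or> J \<subseteq> I"
      by auto
    then show "I = J"
      using I J unfolding biruns_def by blast
  qed
  show "Min ` biruns n \<pi> \<subseteq> {k \<in> {1..<n}. k = 1 \<or> ?d k \<noteq> ?d (k - 1)}"
  proof (rule image_subsetI)
    fix I assume "I \<in> biruns n \<pi>"
    then obtain j where "Min I < j" "j \<le> n" "1 \<le> Min I" "Min I = 1 \<or> ?d (Min I) \<noteq> ?d (Min I - 1)"
      using block[OF _ refl] by blast
    then show "Min I \<in> {k \<in> {1..<n}. k = 1 \<or> ?d k \<noteq> ?d (k - 1)}"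
      by simp
  qed
  show "{k \<in> {1..<n}. k = 1 \<or> ?d k \<noteq> ?d (k - 1)} \<subseteq> Min ` biruns n \<pi>"
  proof
    fix i assume "i \<in> {k \<in> {1..<n}. k = 1 \<or> ?d k \<noteq> ?d (k - 1)}"
    then have i: "1 \<le> i" "i < n" "i = 1 \<or> ?d i \<noteq> ?d (i - 1)"
      by auto
    define e where "e = ?d i"
    \<comment> \<open>The right ends up to which the direction of the step at \<open>i\<close>
      persists; the largest one closes the birun starting at \<open>i\<close>.\<close>
    define S where "S = {j \<in> {i<..n}. \<forall>k\<in>{i..<j}. ?d k = e}"
    have S: "finite S" "Suc i \<in> S"
      using i by (auto simp: S_def e_def less_Suc_eq)
    define j where "j = Max S"
    have "j \<in> S"
      unfolding j_def by (rule Max_in) (use S in auto)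
    then have j: "i < j" "j \<le> n" "\<And>k. k \<in> {i..<j} \<Longrightarrow> ?d k = e"
      by (auto simp: S_def)
    have "J = {i..j}" if J: "monotone_block n \<pi> J" "{i..j} \<subseteq> J" for J
    proof -
      obtain i' j' e' where j': "1 \<le> i'" "i' \<le> j'" "j' \<le> n" "J = {i'..j'}"
        and e': "\<And>k. k \<in> {i'..<j'} \<Longrightarrow> ?d k = e'"
        using J(1) unfolding mb by blast
      have le: "i' \<le> i" "j \<le> j'"
        using J(2) j(1) j' by auto
      have "e' = e"
        unfolding e_def using e'[of i] le j(1) by auto
      \<comment> \<open>A block starting earlier would contain the steps on both sides of the
        turning point \<open>i\<close>.\<close>
      have "i' = i"
      proof (rule ccontr)
        assume "i' \<noteq> i"
        then have "i - 1 \<in> {i'..<j'}" "i \<noteq> 1"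
          using le j(1) j' by auto
        then show False
          using i(3) e'[of "i - 1"] \<open>e' = e\<close> e_def by simp
      qed
      then have "j' \<in> S"
        using j'(3) j(1) le e' \<open>e' = e\<close> by (auto simp: S_def)
      then have "j' \<le> j"
        unfolding j_def using S by simp
      then show ?thesis
        using \<open>i' = i\<close> le j' by simp
    qed
    moreover have "monotone_block n \<pi> {i..j}"
      by (rule mbI[where e = e]) (use i j in auto)
    ultimately have "{i..j} \<in> biruns n \<pi>"
      by (simp add: biruns_def)
    moreover have "Min {i..j} = i"
      using j(1) by (intro Min_eqI) auto
    ultimately show "i \<in> Min ` biruns n \<pi>"
      by (intro image_eqI[where x = "{i..j}"]) simp_all
  qed
qed

text \<open>Biruns start at 1 and at the later turning points. After an initial ascent, position 1
  is no change from the conventional ascent at 0, so the birun starting there gives the additional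
  1. After an initial descent, position 1 is itself a change, and the extra run \<open>{1}\<close>
  gives the additional 1.\<close>

lemma udr_eq_changes:
  assumes perm: "\<pi> permutes {1..n}" and n: "1 \<le> n"
  shows "udr n \<pi> = Suc (changes (ascent \<pi>) (n - 1))"
proof (cases "n = 1")
  case True
  have "biruns 1 \<pi> = {{1}}"
  proof -
    have "monotone_block 1 \<pi> I \<longleftrightarrow> I = {1}" for I
      unfolding monotone_block_def by (auto simp: le_Suc_eq strict_mono_on_def intro!: exI[of _ "Suc 0"])
    then show ?thesis
      by (auto simp: biruns_def)
  qed
  with True show ?thesis
    by (simp add: udr_def up_down_runs_def)
next
  case False
  with n have n: "2 \<le> n"
    by simp
  let ?d = "ascent \<pi>" and ?L = "{k \<in> {1..<n}. k = 1 \<or> ascent \<pi> k \<noteq> ascent \<pi> (k - 1)}"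
  let ?C = "{k \<in> {1..n - 1}. ascent \<pi> k \<noteq> ascent \<pi> (k - 1)}"
  have inj: "inj_on \<pi> {1..n}"
    using perm by (rule permutes_inj_on)
  have bij: "bij_betw Min (biruns n \<pi>) ?L"
    by (rule bij_betw_biruns_left_end) fact+
  have fin: "finite (biruns n \<pi>)"
    using bij_betw_finite[OF bij] by simp
  have card: "card (biruns n \<pi>) = card ?L"
    using bij by (rule bij_betw_same_card)
  have d0: "?d 0"
    by (simp add: ascent_def)
  show ?thesis
  proof (cases "?d 1")
    case True
    have "\<not> \<pi> 1 > \<pi> 2"
      using True by (auto simp: ascent_def numeral_2_eq_2)
    then have "udr n \<pi> = card ?L"
      by (simp add: udr_def up_down_runs_def card)
    also have "?L = insert 1 ?C"
      using n by auto
    also have "card \<dots> = Suc (card ?C)"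
      using True d0 by (subst card_insert_disjoint) auto
    finally show ?thesis
      by (simp add: changes_def)
  next
    case False
    have "\<pi> 1 \<noteq> \<pi> 2"
      using inj_onD[OF inj, of 1 2] n by auto
    then have gt: "\<pi> 1 > \<pi> 2"
      using False by (auto simp: ascent_def numeral_2_eq_2)
    \<comment> \<open>The extra run must not coincide with a birun, so that it really adds one to
      the count.\<close>
    have "{1} \<notin> biruns n \<pi>"
    proof
      assume "{1} \<in> biruns n \<pi>"
      moreover have "monotone_block n \<pi> {1..2}"
        unfolding monotone_block_iff[OF inj] using n
        by (intro exI[of _ 1] exI[of _ 2] exI[of _ "ascent \<pi> 1"]) (auto simp: numeral_2_eq_2 less_Suc_eq)
      ultimately have "{1..2} = {1::nat}"
        unfolding biruns_def by auto
      from arg_cong[OF this, of card] show False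
        by simp
    qed
    then have "udr n \<pi> = Suc (card ?L)"
      using gt n fin by (simp add: udr_def up_down_runs_def card)
    also have "?L = ?C"
      using n False d0 by auto
    finally show ?thesis
      by (simp add: changes_def)
  qed
qed

subsection \<open>Standardization\<close>

text \<open>The order in which standardization numbers positions: by letter, with ties read from
  left to right for odd letters and from right to left for even ones. Repeated odd letters thus
  receive increasing values and repeated even letters decreasing ones.\<close>

definition std_less :: "(nat \<Rightarrow> nat) \<Rightarrow> nat \<Rightarrow> nat \<Rightarrow> bool" where
  "std_less w k l \<longleftrightarrow> w k < w l \<or> w k = w l \<and> (if odd (w k) then k < l else l < k)"

lemma std_less_trans: "std_less w k l \<Longrightarrow> std_less w l m \<Longrightarrow> std_less w k m"
  by (auto simp: std_less_def split: if_splits)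

lemma std_less_irrefl [simp]: "\<not> std_less w k k"
  by (simp add: std_less_def)

lemma std_less_linear: "std_less w k l \<or> k = l \<or> std_less w l k"
  by (auto simp: std_less_def split: if_splits)

definition standardization :: "nat \<Rightarrow> (nat \<Rightarrow> nat) \<Rightarrow> nat \<Rightarrow> nat" where
  "standardization n w k = (if k \<in> {1..n} then Suc (card {l \<in> {1..n}. std_less w l k}) else k)"

lemma standardization_less_iff:
  assumes "k \<in> {1..n}" "l \<in> {1..n}"
  shows "standardization n w k < standardization n w l \<longleftrightarrow> std_less w k l"
proof -
  have *: "standardization n w i < standardization n w j" if "std_less w i j" "i \<in> {1..n}" "j \<in> {1..n}" for i j
  proof -
    have "i \<in> {m \<in> {1..n}. std_less w m j}" "i \<notin> {m \<in> {1..n}. std_less w m i}"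
      using that by auto
    then have "{m \<in> {1..n}. std_less w m i} \<subset> {m \<in> {1..n}. std_less w m j}"
      using std_less_trans[OF _ that(1)] by blast
    then have "card {m \<in> {1..n}. std_less w m i} < card {m \<in> {1..n}. std_less w m j}"
      by (intro psubset_card_mono) auto
    then show ?thesis
      using that by (simp add: standardization_def)
  qed
  show ?thesis
    using *[of k l] *[of l k] std_less_linear[of w k l] assms by fastforce
qed

lemma standardization_permutes: "standardization n w permutes {1..n}"
proof (rule bij_imp_permutes)
  have "inj_on (standardization n w) {1..n}"
    by (rule inj_onI) (metis less_irrefl standardization_less_iff std_less_linear)
  moreover have "standardization n w ` {1..n} \<subseteq> {1..n}"
  proof safe
    fix k assume k: "k \<in> {1..n}"
    have "k \<notin> {l \<in> {1..n}. std_less w l k}"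
      by simp
    then have "card {l \<in> {1..n}. std_less w l k} < card {1..n}"
      using k by (intro psubset_card_mono) blast+
    then show "standardization n w k \<in> {1..n}"
      using k by (simp add: standardization_def)
  qed
  ultimately show "bij_betw (standardization n w) {1..n} {1..n}"
    by (simp add: bij_betw_def endo_inj_surj)
qed (auto simp: standardization_def)

text \<open>Each value of a permutation is its own rank among the values, so the relative order of
  the values determines the permutation.\<close>

lemma permutes_eqI_less:
  assumes p: "p permutes {1..n}" and q: "q permutes {1..n::nat}"
    and less: "\<And>k l. k \<in> {1..n} \<Longrightarrow> l \<in> {1..n} \<Longrightarrow> p k < p l \<longleftrightarrow> q k < q l"
  shows "p = q"
proof
  fix k
  have rank: "r k = Suc (card {l \<in> {1..n}. r l < r k})" if r: "r permutes {1..n}" and k: "k \<in> {1..n}" for r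
  proof -
    have "r ` {l \<in> {1..n}. r l < r k} = {1..<r k}"
    proof (intro equalityI subsetI)
      fix m assume "m \<in> r ` {l \<in> {1..n}. r l < r k}"
      then show "m \<in> {1..<r k}"
        using permutes_in_image[OF r] by fastforce
    next
      fix m assume m: "m \<in> {1..<r k}"
      moreover have "r k \<in> {1..n}"
        using permutes_in_image[OF r] k by blast
      ultimately have "m \<in> {1..n}"
        by auto
      then obtain l where "l \<in> {1..n}" "m = r l"
        using permutes_image[OF r] by (metis imageE)
      with m show "m \<in> r ` {l \<in> {1..n}. r l < r k}"
        by auto
    qed
    then have "card {l \<in> {1..n}. r l < r k} = r k - 1"
      by (metis card_atLeastLessThan card_image permutes_inj_on[OF r])
    moreover have "r k \<ge> 1"
      using permutes_in_image[OF r] k by fastforce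
    ultimately show ?thesis
      by simp
  qed
  show "p k = q k"
  proof (cases "k \<in> {1..n}")
    case True
    then have "{l \<in> {1..n}. p l < p k} = {l \<in> {1..n}. q l < q k}"
      using less by blast
    with True show ?thesis
      using rank[OF p] rank[OF q] by metis
  next
    case False
    then show ?thesis
      using p q by (metis permutes_not_in)
  qed
qed

text \<open>This recovers \<pi> from the word obtained by composing \<open>v\<close> with \<pi>: its
  positions, listed by increasing value of \<pi>, are increasing for \<open>std_less\<close>. It
  suffices to check consecutive values, by transitivity; the converse follows from
  asymmetry.\<close>

lemma less_iff_std_less:
  assumes perm: "\<pi> permutes {1..n}" and v: "v \<in> labellings b n (ascent (inv \<pi>))"
    and k: "k \<in> {1..n}" and l: "l \<in> {1..n}"
  shows "\<pi> k < \<pi> l \<longleftrightarrow> std_less (\<lambda>k. v (\<pi> k)) k l"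
proof -
  let ?w = "\<lambda>k. v (\<pi> k)"
  have pi_inv: "\<pi> (inv \<pi> m) = m" "inv \<pi> (\<pi> m) = m" for m
    using permutes_inverses[OF perm] by auto
  \<comment> \<open>For equal consecutive labels, the labelling condition on the inverse is exactly
    the parity rule for breaking ties.\<close>
  have step: "std_less ?w (inv \<pi> m) (inv \<pi> (Suc m))" if "m \<in> {1..<n}" for m
  proof -
    have "v m < v (Suc m) \<or> v m = v (Suc m) \<and> (odd (v m) \<longleftrightarrow> inv \<pi> m < inv \<pi> (Suc m))"
      using v that by (auto simp: labellings_def rel_chains_def ascent_def)
    moreover have "inv \<pi> m \<noteq> inv \<pi> (Suc m)"
      by (metis n_not_Suc_n pi_inv(1))
    ultimately show ?thesis
      by (auto simp: std_less_def pi_inv)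
  qed
  have chain: "std_less ?w (inv \<pi> m) (inv \<pi> m')" if m: "1 \<le> m" and "Suc m \<le> m'" "m' \<le> n" for m m'
    using that(2,3)
  proof (induction m' rule: dec_induct)
    case base
    then show ?case
      using step m by auto
  next
    case (step m')
    then show ?case
      using \<open>\<And>m. m \<in> {1..<n} \<Longrightarrow> std_less ?w (inv \<pi> m) (inv \<pi> (Suc m))\<close>[of m'] m
      by (auto intro: std_less_trans)
  qed
  have *: "std_less ?w i j" if "\<pi> i < \<pi> j" "i \<in> {1..n}" "j \<in> {1..n}" for i j
  proof -
    have "\<pi> i \<in> {1..n}" "\<pi> j \<in> {1..n}"
      using that permutes_in_image[OF perm] by blast+
    then show ?thesis
      using chain[of "\<pi> i" "\<pi> j"] that by (simp add: pi_inv)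
  qed
  show ?thesis
  proof
    assume s: "std_less ?w k l"
    then have "k \<noteq> l"
      by auto
    then have "\<pi> k \<noteq> \<pi> l"
      by (metis pi_inv(2))
    moreover have "\<not> \<pi> l < \<pi> k"
      using *[OF _ l k] s std_less_trans[of ?w k l k] by auto
    ultimately show "\<pi> k < \<pi> l"
      by simp
  qed (use * k l in blast)
qed

text \<open>Reading the letters of \<open>w\<close> in the order of their standardized values gives
  a weakly increasing word, and the tie rule is the repetition rule for the inverse.\<close>

lemma standardization_labelling:
  assumes w: "w \<in> {1..n} \<rightarrow>\<^sub>E {1..b}"
  shows "restrict (\<lambda>m. w (inv (standardization n w) m)) {1..n}
    \<in> labellings b n (ascent (inv (standardization n w)))"
proof -
  define \<pi> where "\<pi> = standardization n w"
  have perm: "\<pi> permutes {1..n}"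
    unfolding \<pi>_def by (rule standardization_permutes)
  have inv: "inv \<pi> permutes {1..n}"
    using perm by (rule permutes_inv)
  have pi_inv: "\<pi> (inv \<pi> m) = m" "inv \<pi> (\<pi> m) = m" for m
    using permutes_inverses[OF perm] by auto
  have mem: "inv \<pi> m \<in> {1..n}" if "m \<in> {1..n}" for m
    using that permutes_in_image[OF inv] by blast
  have "std_less w (inv \<pi> m) (inv \<pi> (Suc m))" if m: "m \<in> {1..<n}" for m
    using standardization_less_iff[of "inv \<pi> m" n "inv \<pi> (Suc m)" w] m mem[of m] mem[of "Suc m"]
    unfolding \<pi>_def[symmetric] by (simp add: pi_inv)
  then have "w (inv \<pi> m) < w (inv \<pi> (Suc m)) \<or> w (inv \<pi> m) = w (inv \<pi> (Suc m)) \<and>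
      (odd (w (inv \<pi> m)) \<longleftrightarrow> ascent (inv \<pi>) m)" if "m \<in> {1..<n}" for m
    using that by (fastforce simp: std_less_def ascent_def split: if_splits)
  moreover have "w (inv \<pi> m) \<in> {1..b}" if "m \<in> {1..n}" for m
    using w mem[OF that] by blast
  ultimately show ?thesis
    unfolding \<pi>_def[symmetric] by (auto simp: labellings_def rel_chains_def)
qed

text \<open>Here \<open>w\<close> stands for a labelling of the inverse composed with \<pi>. Since
  \<pi> is the standardization of \<open>w\<close>, its ascents can be expressed by
  \<open>std_less w\<close>, and the permutation disappears from the description.\<close>

definition word_pairs :: "nat \<Rightarrow> nat \<Rightarrow> nat \<Rightarrow> ((nat \<Rightarrow> nat) \<times> (nat \<Rightarrow> nat)) set" where
  "word_pairs a b n = {(u, w). u \<in> {1..n} \<rightarrow>\<^sub>E {1..a} \<and> w \<in> {1..n} \<rightarrow>\<^sub>E {1..b} \<and>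
     (\<forall>k\<in>{1..<n}. u k < u (Suc k) \<or> u k = u (Suc k) \<and> (odd (u k) \<longleftrightarrow> std_less w k (Suc k)))}"

text \<open>The triple of \<pi>, \<open>u\<close> and \<open>v\<close> is sent to \<open>u\<close>
  and the composition of \<open>v\<close> with \<pi>; standardizing the second word recovers \<pi>
  and then \<open>v\<close>.\<close>

lemma sum_labellings_eq_card_word_pairs:
  "(\<Sum>\<pi> | \<pi> permutes {1..n}. card (labellings a n (ascent \<pi>)) * card (labellings b n (ascent (inv \<pi>)))) =
    card (word_pairs a b n)"
proof -
  let ?D = "SIGMA \<pi>:{\<pi>. \<pi> permutes {1..n}}. labellings a n (ascent \<pi>) \<times> labellings b n (ascent (inv \<pi>))"
  have fin: "finite (labellings c n d)" for c d
    unfolding labellings_def by (rule finite_rel_chains) simp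
  have "(\<Sum>\<pi> | \<pi> permutes {1..n}. card (labellings a n (ascent \<pi>)) * card (labellings b n (ascent (inv \<pi>)))) = card ?D"
    using fin by (subst card_SigmaI) (auto simp: finite_permutations card_cartesian_product)
  also have "\<dots> = card (word_pairs a b n)"
  proof (rule bij_betw_same_card[OF bij_betw_byWitness[where
        f = "\<lambda>(\<pi>, u, v). (u, restrict (\<lambda>k. v (\<pi> k)) {1..n})" and
        f' = "\<lambda>(u, w). (standardization n w, u,
           restrict (\<lambda>m. w (inv (standardization n w) m)) {1..n})"]])
    have main: "standardization n (restrict (\<lambda>k. v (\<pi> k)) {1..n}) = \<pi> \<and>
        restrict (\<lambda>m. restrict (\<lambda>k. v (\<pi> k)) {1..n} (inv \<pi> m)) {1..n} = v \<and>
        (u, restrict (\<lambda>k. v (\<pi> k)) {1..n}) \<in> word_pairs a b n"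
      if perm: "\<pi> permutes {1..n}" and u: "u \<in> labellings a n (ascent \<pi>)" and v: "v \<in> labellings b n (ascent (inv \<pi>))"
      for \<pi> u v
    proof (intro conjI)
      let ?w = "restrict (\<lambda>k. v (\<pi> k)) {1..n}"
      have less: "\<pi> k < \<pi> l \<longleftrightarrow> std_less ?w k l" if "k \<in> {1..n}" "l \<in> {1..n}" for k l
        using less_iff_std_less[OF perm v that] that
        by (simp add: std_less_def)
      show "standardization n ?w = \<pi>"
        by (rule permutes_eqI_less[OF standardization_permutes perm])
          (simp add: less standardization_less_iff)
      have inv: "inv \<pi> permutes {1..n}"
        using perm by (rule permutes_inv)
      have vE: "v \<in> {1..n} \<rightarrow>\<^sub>E {1..b}"
        using v by (simp add: labellings_def rel_chains_def)
      show "restrict (\<lambda>m. ?w (inv \<pi> m)) {1..n} = v"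
      proof
        fix m show "restrict (\<lambda>m. ?w (inv \<pi> m)) {1..n} m = v m"
        proof (cases "m \<in> {1..n}")
          case True
          then have "inv \<pi> m \<in> {1..n}"
            using permutes_in_image[OF inv] by blast
          with True show ?thesis
            using permutes_inverses(1)[OF perm] by simp
        next
          case False
          then show ?thesis
            using vE by (auto simp: PiE_def extensional_def)
        qed
      qed
      have "?w \<in> {1..n} \<rightarrow>\<^sub>E {1..b}"
        using vE permutes_in_image[OF perm] by fastforce
      moreover have "ascent \<pi> k \<longleftrightarrow> std_less ?w k (Suc k)" if "k \<in> {1..<n}" for k
        using less[of k "Suc k"] that by (simp add: ascent_def)
      ultimately show "(u, ?w) \<in> word_pairs a b n"
        using u by (auto simp: word_pairs_def labellings_def rel_chains_def)
    qed
    have main': "u \<in> labellings a n (ascent (standardization n w)) \<and>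
       restrict (\<lambda>k. restrict (\<lambda>m. w (inv (standardization n w) m)) {1..n} (standardization n w k)) {1..n} = w"
       if uw: "(u, w) \<in> word_pairs a b n" for u w
    proof
      have "ascent (standardization n w) k \<longleftrightarrow> std_less w k (Suc k)" if "k \<in> {1..<n}" for k
        using standardization_less_iff[of k n "Suc k" w] that by (simp add: ascent_def)
      then show "u \<in> labellings a n (ascent (standardization n w))"
        using uw by (auto simp: word_pairs_def labellings_def rel_chains_def)
      show "restrict (\<lambda>k. restrict (\<lambda>m. w (inv (standardization n w) m)) {1..n} (standardization n w k)) {1..n} = w"
      proof
        fix k show "restrict (\<lambda>k. restrict (\<lambda>m. w (inv (standardization n w) m)) {1..n} (standardization n w k)) {1..n} k = w k"
        proof (cases "k \<in> {1..n}")
          case True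
          then have "standardization n w k \<in> {1..n}"
            using permutes_in_image[OF standardization_permutes] by blast
          with True show ?thesis
            using permutes_inverses(2)[OF standardization_permutes] by simp
        next
          case False
          then show ?thesis
            using uw by (auto simp: word_pairs_def PiE_def extensional_def)
        qed
      qed
    qed
    show "\<forall>x\<in>?D. (\<lambda>(u, w). (standardization n w, u, restrict (\<lambda>m. w (inv (standardization n w) m)) {1..n}))
        ((\<lambda>(\<pi>, u, v). (u, restrict (\<lambda>k. v (\<pi> k)) {1..n})) x) = x"
      using main by auto
    show "\<forall>y\<in>word_pairs a b n. (\<lambda>(\<pi>, u, v). (u, restrict (\<lambda>k. v (\<pi> k)) {1..n}))
        ((\<lambda>(u, w). (standardization n w, u, restrict (\<lambda>m. w (inv (standardization n w) m)) {1..n})) y) = y"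
      using main' by auto
    show "(\<lambda>(\<pi>, u, v). (u, restrict (\<lambda>k. v (\<pi> k)) {1..n})) ` ?D \<subseteq> word_pairs a b n"
      using main by auto
    show "(\<lambda>(u, w). (standardization n w, u, restrict (\<lambda>m. w (inv (standardization n w) m)) {1..n})) ` word_pairs a b n \<subseteq> ?D"
    proof safe
      fix u w assume uw: "(u, w) \<in> word_pairs a b n"
      then show "restrict (\<lambda>m. w (inv (standardization n w) m)) {1..n} \<in> labellings b n (ascent (inv (standardization n w)))"
        by (intro standardization_labelling) (simp add: word_pairs_def)
      show "u \<in> labellings a n (ascent (standardization n w))"
        using main'[OF uw] by simp
    qed (rule standardization_permutes)
  qed
  finally show ?thesis .
qed

text \<open>The cells of the grid are traversed row by row, alternately in increasing and decreasing
  direction; a word pair is then exactly a chain for this order.\<close>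

definition cell_key :: "nat \<Rightarrow> nat \<times> nat \<Rightarrow> nat" where
  "cell_key b = (\<lambda>(c, e). c * Suc b + (if odd c then e else b - e))"

text \<open>The offset within a row is at most \<open>b\<close>, less than the row stride
  \<open>Suc b\<close>, so the key ranges of different rows are disjoint.\<close>

lemma cell_key_less_iff:
  assumes "e \<in> {1..b}" "e' \<in> {1..b}"
  shows "cell_key b (c, e) < cell_key b (c', e') \<longleftrightarrow> c < c' \<or> c = c' \<and> (if odd c then e < e' else e' < e)"
proof -
  have lt: "cell_key b (c, e) < cell_key b (c', e')" if "c < c'" "e \<in> {1..b}" for c c' e e'
  proof -
    have "cell_key b (c, e) < c * Suc b + Suc b"
      using that by (auto simp: cell_key_def)
    also have "\<dots> = Suc c * Suc b"
      by simp
    also have "\<dots> \<le> c' * Suc b"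
      using that by (intro mult_le_mono1) simp
    also have "\<dots> \<le> cell_key b (c', e')"
      by (simp add: cell_key_def)
    finally show ?thesis .
  qed
  show ?thesis
  proof (cases c c' rule: linorder_cases)
    case equal
    then show ?thesis
      using assms by (auto simp: cell_key_def)
  qed (use lt[of c c' e e'] lt[of c' c e' e] assms in auto)
qed

text \<open>The two words are read together as one word of cells. Within an odd row the next column
  must be larger and within an even row smaller, unless the cell repeats; a repeat needs row and
  column of equal parity, which makes the cell white.\<close>

lemma card_word_pairs:
  "card (word_pairs a b n) = card (rel_chains n ({1..a} \<times> {1..b})
     (\<lambda>_ x y. cell_key b x < cell_key b y \<or> x = y \<and> even (fst x + snd x)))"
proof (rule bij_betw_same_card[OF bij_betw_byWitness[where
        f = "\<lambda>(u, w). restrict (\<lambda>k. (u k, w k)) {1..n}" and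
        f' = "\<lambda>p. (restrict (fst \<circ> p) {1..n}, restrict (snd \<circ> p) {1..n})"]])
  let ?C = "rel_chains n ({1..a} \<times> {1..b})
     (\<lambda>_ x y. cell_key b x < cell_key b y \<or> x = y \<and> even (fst x + snd x))"
  have iff: "c < c' \<or> c = c' \<and> (odd c \<longleftrightarrow> e < e' \<or> e = e' \<and> odd e) \<longleftrightarrow>
      cell_key b (c, e) < cell_key b (c', e') \<or> (c, e) = (c', e') \<and> even (c + e)"
    if "e \<in> {1..b}" "e' \<in> {1..b}" for c c' e e'
    unfolding cell_key_less_iff[OF that] by auto
  have std: "std_less w k (Suc k) \<longleftrightarrow> w k < w (Suc k) \<or> w k = w (Suc k) \<and> odd (w k)" for w k
    by (auto simp: std_less_def)
  show "(\<lambda>(u, w). restrict (\<lambda>k. (u k, w k)) {1..n}) ` word_pairs a b n \<subseteq> ?C"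
  proof safe
    fix u w assume uw: "(u, w) \<in> word_pairs a b n"
    then have ran: "w k \<in> {1..b}" "u k \<in> {1..a}" if "k \<in> {1..n}" for k
      using that unfolding word_pairs_def by blast+
    have "cell_key b (u k, w k) < cell_key b (u (Suc k), w (Suc k)) \<or>
        (u k, w k) = (u (Suc k), w (Suc k)) \<and> even (u k + w k)" if k: "k \<in> {1..<n}" for k
      using uw k iff[of "w k" "w (Suc k)" "u k" "u (Suc k)"] ran[of k] ran[of "Suc k"]
      unfolding word_pairs_def std by auto
    with ran show "restrict (\<lambda>k. (u k, w k)) {1..n} \<in> ?C"
      by (auto simp: rel_chains_def)
  qed
  show "(\<lambda>p. (restrict (fst \<circ> p) {1..n}, restrict (snd \<circ> p) {1..n})) ` ?C \<subseteq> word_pairs a b n"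
  proof safe
    fix p assume p: "p \<in> ?C"
    have ran: "fst (p k) \<in> {1..a}" "snd (p k) \<in> {1..b}" if "k \<in> {1..n}" for k
      using p that unfolding rel_chains_def by (auto simp: PiE_def Pi_def mem_Times_iff)
    have "fst (p k) < fst (p (Suc k)) \<or> fst (p k) = fst (p (Suc k)) \<and>
        (odd (fst (p k)) \<longleftrightarrow> snd (p k) < snd (p (Suc k)) \<or> snd (p k) = snd (p (Suc k)) \<and> odd (snd (p k)))"
      if k: "k \<in> {1..<n}" for k
      using p k iff[of "snd (p k)" "snd (p (Suc k))" "fst (p k)" "fst (p (Suc k))"] ran[of k] ran[of "Suc k"]
      unfolding rel_chains_def by auto
    with ran show "(restrict (fst \<circ> p) {1..n}, restrict (snd \<circ> p) {1..n}) \<in> word_pairs a b n"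
      by (auto simp: word_pairs_def std)
  qed
qed (auto simp: word_pairs_def rel_chains_def PiE_def extensional_def fun_eq_iff restrict_def)

lemma inj_on_cell_key: "inj_on (cell_key b) ({1..a} \<times> {1..b})"
proof (rule inj_onI, clarify)
  fix c e c' e' assume "e \<in> {1..b}" "e' \<in> {1..b}" and eq: "cell_key b (c, e) = cell_key b (c', e')"
  then show "c = c' \<and> e = e'"
    using cell_key_less_iff[of e b e' c c'] cell_key_less_iff[of e' b e c' c] 
    by (metis less_irrefl linorder_cases)
qed

subsection \<open>Power series in three variables\<close>

lemma prod_checkerboard_row:
  fixes y z :: "'a::comm_monoid_mult"
  shows "(\<Prod>e\<in>{1..b}. if even (c + e) then y else z) =
    (if odd c then y ^ ((b + 1) div 2) * z ^ (b div 2) else y ^ (b div 2) * z ^ ((b + 1) div 2))"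
proof (induction b)
  case (Suc b)
  then show ?case
    by (cases "even b"; cases "even c") (auto elim!: evenE oddE simp: mult_ac)
qed simp

text \<open>The corner cell (1, 1) is white, so when the number of cells is odd the white ones are
  one more than the black ones.\<close>

lemma prod_checkerboard:
  fixes y z :: "'a::comm_monoid_mult"
  shows "(\<Prod>x\<in>{1..a} \<times> {1..b}. if even (fst x + snd x) then y else z) =
    y ^ ((a * b + 1) div 2) * z ^ (a * b div 2)"
proof -
  have "(\<Prod>c\<in>{1..a}. \<Prod>e\<in>{1..b}. if even (c + e) then y else z) =
      y ^ ((a * b + 1) div 2) * z ^ (a * b div 2)"
  proof (induction a)
    case (Suc a)
    have "(\<Prod>c\<in>{1..Suc a}. \<Prod>e\<in>{1..b}. if even (c + e) then y else z) =
        (y ^ ((a * b + 1) div 2) * z ^ (a * b div 2)) *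
        (if even a then y ^ ((b + 1) div 2) * z ^ (b div 2) else y ^ (b div 2) * z ^ ((b + 1) div 2))"
      unfolding prod.cl_ivl_Suc Suc.IH unfolding prod_checkerboard_row by simp
    also have "\<dots> = y ^ ((a * b + 1) div 2 + (if even a then (b + 1) div 2 else b div 2))
        * z ^ (a * b div 2 + (if even a then b div 2 else (b + 1) div 2))"
      by (simp add: power_add mult_ac)
    also have "(a * b + 1) div 2 + (if even a then (b + 1) div 2 else b div 2) = (Suc a * b + 1) div 2"
      by (cases "even a"; cases "even b") (auto elim!: evenE oddE simp: algebra_simps)
    also have "a * b div 2 + (if even a then b div 2 else (b + 1) div 2) = Suc a * b div 2"
      by (cases "even a"; cases "even b") (auto elim!: evenE oddE simp: algebra_simps)
    finally show ?case .
  qed simp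
  then show ?thesis
    by (simp add: prod.cartesian_product case_prod_beta)
qed

lemma word_pairs_gf:
  "Abs_fps (\<lambda>n. of_nat (card (word_pairs a b n))) =
    inverse (1 - fps_X) ^ ((a * b + 1) div 2) * (1 + fps_X :: rat fps) ^ (a * b div 2)"
  unfolding card_word_pairs prod_checkerboard[symmetric]
  by (rule rel_chains_gf) (simp_all add: inj_on_cell_key del: One_nat_def)

section \<open>Embedding univariate series into the series in three variables\<close>

definition fps_embed :: "'a::comm_ring_1 fps \<Rightarrow> 'a fps fps" where
  "fps_embed f = Abs_fps (\<lambda>n. fps_const (f $ n))"

lemma fps_embed_nth [simp]: "fps_embed f $ n = fps_const (f $ n)"
  by (simp add: fps_embed_def)

lemma fps_const_sum': "fps_const (sum f A) = (\<Sum>x\<in>A. fps_const (f x))"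
  by (induction A rule: infinite_finite_induct) (simp_all flip: fps_const_add)

lemma fps_embed_add: "fps_embed (f + g) = fps_embed f + fps_embed g"
  by (rule fps_ext) simp

lemma fps_embed_diff: "fps_embed (f - g) = fps_embed f - fps_embed g"
  by (rule fps_ext) simp

lemma fps_embed_mult: "fps_embed (f * g) = fps_embed f * fps_embed g"
  by (rule fps_ext) (simp add: fps_mult_nth fps_const_sum')

lemma fps_embed_1 [simp]: "fps_embed 1 = 1"
  by (rule fps_ext) simp

lemma fps_embed_power: "fps_embed (f ^ n) = fps_embed f ^ n"
  by (induction n) (simp_all add: fps_embed_mult)

lemma fps_embed_X [simp]: "fps_embed fps_X = fps_X"
  by (rule fps_ext) simp

text \<open>The outermost variable is x, so a series in x is embedded twice, with coefficients
  constant first in s and then in t.\<close>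

definition in_x :: "rat fps \<Rightarrow> fps_stx" where
  "in_x f = fps_embed (fps_embed f)"

lemma in_x_hom:
  "in_x (f + g) = in_x f + in_x g" "in_x (f - g) = in_x f - in_x g" "in_x (f * g) = in_x f * in_x g"
  "in_x 1 = 1" "in_x (f ^ n) = in_x f ^ n" "in_x fps_X = var_x"
  by (simp_all add: in_x_def var_x_def fps_embed_add fps_embed_diff fps_embed_mult fps_embed_power)

text \<open>Quotients are identified by multiplying back: the nonzero constant coefficient makes the
  division genuine, and \<open>g\<close> cancels.\<close>

lemma divide_eq_stxI:
  fixes f g h :: fps_stx
  assumes "g $ 0 $ 0 $ 0 \<noteq> 0" "f = h * g"
  shows "f / g = h"
proof -
  have "f / g * g = h * g"
    using fps_stx_divide_mult[OF assms(1)] assms(2) by simp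
  moreover have "g \<noteq> 0"
    using assms(1) by auto
  ultimately show ?thesis
    by simp
qed

lemma in_x_divide:
  "in_x (f * inverse (1 - fps_X) ^ m) = in_x f / (1 - var_x) ^ m"
proof (rule divide_eq_stxI[symmetric])
  have "inverse (1 - fps_X :: rat fps) * (1 - fps_X) = 1"
    by (rule inverse_mult_eq_1) simp
  then have "(inverse (1 - fps_X :: rat fps) ^ m) * (1 - fps_X) ^ m = 1"
    by (simp flip: power_mult_distrib)
  then have "f * inverse (1 - fps_X) ^ m * (1 - fps_X) ^ m = f"
    by (simp add: mult.assoc)
  from arg_cong[OF this, of in_x] show "in_x f = in_x (f * inverse (1 - fps_X) ^ m) * (1 - var_x) ^ m"
    unfolding in_x_hom by (rule sym)
qed (simp add: var_x_def fps_power_zeroth)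

lemma monomial_nth:
  "(in_x f * var_s ^ a * var_t ^ b) $ n $ j $ i = (if i = a \<and> j = b then f $ n else 0)"
proof -
  have eq: "in_x f * var_s ^ a * var_t ^ b = in_x f * fps_const (fps_const (fps_X ^ a) * fps_X ^ b)"
    by (simp add: var_s_def var_t_def fps_const_power mult.assoc)
  show ?thesis
    unfolding eq by (simp add: in_x_def fps_X_power_mult_right_nth mult.assoc[symmetric])
qed

section \<open>Coefficients of the right-hand side\<close>

definition grid_gf :: "nat \<Rightarrow> nat \<Rightarrow> rat fps" where
  "grid_gf a b = Abs_fps (\<lambda>n. of_nat (card (word_pairs a b n)))"

text \<open>The summand for \<open>i\<close>, \<open>j\<close> collects the four grids whose side
  lengths halve to \<open>i\<close> and \<open>j\<close>. Half the number of cells, rounded down, is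
  2ij, 2ij + j, 2ij + i or 2ij + i + j; only the last grid has an odd number of cells, hence an
  additional factor 1 / (1 - x).\<close>

lemma rhs_term_eq:
  fixes i j :: nat
  defines "q \<equiv> (1 + var_x) / (1 - var_x)"
  shows "q ^ (2 * i * j) * (1 + var_s * q ^ j + var_t * q ^ i
      + var_s * var_t * ((1 + var_x) ^ (i + j) / (1 - var_x) ^ (i + j + 1))) * var_s ^ (2 * i) * var_t ^ (2 * j) =
    (\<Sum>(a, b)\<in>{2 * i, 2 * i + 1} \<times> {2 * j, 2 * j + 1}. in_x (grid_gf a b) * var_s ^ a * var_t ^ b)"
proof -
  define y z :: "rat fps" where "y = inverse (1 - fps_X)" and "z = 1 + fps_X"
  have q: "q = in_x (z * y)"
    unfolding q_def y_def z_def using in_x_divide[of "1 + fps_X" 1] by (simp add: in_x_hom)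
  have grid: "grid_gf a b = y ^ ((a * b + 1) div 2) * z ^ (a * b div 2)" for a b
    unfolding grid_gf_def word_pairs_gf y_def z_def ..
  have 1: "grid_gf (2 * i) (2 * j) = (z * y) ^ (2 * i * j)"
    unfolding grid by (simp add: power_mult_distrib mult_ac)
  have 2: "grid_gf (2 * i + 1) (2 * j) = (z * y) ^ (2 * i * j) * (z * y) ^ j"
  proof -
    have "(2 * i + 1) * (2 * j) = 2 * (2 * i * j + j)"
      by (simp add: algebra_simps)
    then show ?thesis
      unfolding grid by (simp add: power_mult_distrib power_add mult_ac)
  qed
  have 3: "grid_gf (2 * i) (2 * j + 1) = (z * y) ^ (2 * i * j) * (z * y) ^ i"
  proof -
    have "2 * i * (2 * j + 1) = 2 * (2 * i * j + i)"
      by (simp add: algebra_simps)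
    then show ?thesis
      unfolding grid by (simp add: power_mult_distrib power_add mult_ac)
  qed
  have 4: "grid_gf (2 * i + 1) (2 * j + 1) = (z * y) ^ (2 * i * j) * (z ^ (i + j) * y ^ (i + j + 1))"
  proof -
    have "(2 * i + 1) * (2 * j + 1) = Suc (2 * (2 * i * j + (i + j)))"
      by (simp add: algebra_simps)
    then show ?thesis
      unfolding grid by (simp add: power_mult_distrib power_add mult_ac)
  qed
  have last: "(1 + var_x) ^ (i + j) / (1 - var_x) ^ (i + j + 1) = in_x (z ^ (i + j) * y ^ (i + j + 1))"
    unfolding y_def in_x_divide by (simp add: z_def in_x_hom)
  have sum4: "(\<Sum>(a, b)\<in>{2 * i, 2 * i + 1} \<times> {2 * j, 2 * j + 1}. f a b) =
      f (2 * i) (2 * j) + f (2 * i + 1) (2 * j) + f (2 * i) (2 * j + 1) + f (2 * i + 1) (2 * j + 1)"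
    for f :: "nat \<Rightarrow> nat \<Rightarrow> fps_stx"
    by (simp flip: sum.cartesian_product)
  have expand: "Z * (1 + s * A + t * B + s * t * C) * p * r =
      Z * p * r + Z * A * (p * s) * r + Z * B * p * (r * t) + Z * C * (p * s) * (r * t)"
    for Z A B C s t p r :: fps_stx
    by (simp add: algebra_simps)
  show ?thesis
    unfolding last q sum4 1 2 3 4 unfolding in_x_hom power_add power_one_right expand ..
qed

text \<open>Every pair of exponents of s and t lies in exactly one of these blocks of four, so each
  monomial comes from at most one summand.\<close>

lemma rhs_term_nth:
  "(\<Sum>(a, b)\<in>{2 * i, 2 * i + 1} \<times> {2 * j, 2 * j + 1}. in_x (grid_gf a b) * var_s ^ a * var_t ^ b) $ n $ j' $ i' =
    (if i = i' div 2 \<and> j = j' div 2 then grid_gf i' j' $ n else 0)"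
proof -
  have "(\<Sum>(a, b)\<in>{2 * i, 2 * i + 1} \<times> {2 * j, 2 * j + 1}. in_x (grid_gf a b) * var_s ^ a * var_t ^ b) $ n $ j' $ i' =
      (\<Sum>(a, b)\<in>{2 * i, 2 * i + 1} \<times> {2 * j, 2 * j + 1}. if (a, b) = (i', j') then grid_gf i' j' $ n else 0)"
    unfolding fps_sum_nth
    by (intro sum.cong refl) (auto simp only: monomial_nth prod.case prod.inject split: prod.split, auto)
  also have "\<dots> = (if (i', j') \<in> {2 * i, 2 * i + 1} \<times> {2 * j, 2 * j + 1} then grid_gf i' j' $ n else 0)"
    unfolding case_prod_beta prod.collapse by (rule sum.delta) simp
  also have "(i', j') \<in> {2 * i, 2 * i + 1} \<times> {2 * j, 2 * j + 1} \<longleftrightarrow> i = i' div 2 \<and> j = j' div 2"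
    by auto
  finally show ?thesis .
qed

section \<open>Coefficients of the left-hand side\<close>

definition label_gf :: "nat \<Rightarrow> (nat \<Rightarrow> nat) \<Rightarrow> rat fps" where
  "label_gf n \<pi> = Abs_fps (\<lambda>a. of_nat (card (labellings a n (ascent \<pi>))))"

text \<open>Stated for a general ring homomorphism so that one computation serves both s and t.
  Since the number of runs is at most \<open>n\<close>, pulling 1 + v^2 out of each factor 2v
  completes the power to the exponent \<open>n\<close>.\<close>

lemma label_gf_hom:
  fixes \<phi> :: "rat fps \<Rightarrow> fps_stx"
  assumes hom: "\<And>f g. \<phi> (f + g) = \<phi> f + \<phi> g" "\<And>f g. \<phi> (f * g) = \<phi> f * \<phi> g" "\<phi> 1 = 1"
    and v: "v = \<phi> fps_X" "v $ 0 $ 0 $ 0 = 0"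
    and perm: "\<pi> permutes {1..n}" and n: "1 \<le> n"
  shows "2 * (1 - v)\<^sup>2 * (1 - v\<^sup>2) ^ (n - 1) * \<phi> (label_gf n \<pi>) = (1 + v\<^sup>2) ^ n * (2 * v / (1 + v\<^sup>2)) ^ udr n \<pi>"
proof -
  define k where "k = udr n \<pi>"
  have k: "Suc (changes (ascent \<pi>) (n - 1)) = k"
    unfolding k_def using udr_eq_changes[OF perm n] by simp
  have "k \<le> n"
    using changes_le[of "ascent \<pi>" "n - 1"] k n by simp
  have diff: "\<phi> (f - g) = \<phi> f - \<phi> g" for f g
    using hom(1)[of "f - g" g] by simp
  have pow: "\<phi> (f ^ m) = \<phi> f ^ m" for f m
    by (induction m) (simp_all add: hom)
  have two: "\<phi> 2 = 2"
    using hom(1)[of 1 1] hom(3) by simp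
  have "2 * (1 - v)\<^sup>2 * (1 - v\<^sup>2) ^ (n - 1) * \<phi> (label_gf n \<pi>) = (1 + v\<^sup>2) ^ (n - k) * (2 * v) ^ k"
    using arg_cong[OF labellings_gf[of "ascent \<pi>" n, OF _ n], of \<phi>]
    by (simp only: k hom diff pow two v(1) label_gf_def ascent_def simp_thms)
  \<comment> \<open>The constant coefficient of 1 + v^2 is 1 because that of \<open>v\<close> is 0,
    so the division is genuine.\<close>
  also have "2 * v = 2 * v / (1 + v\<^sup>2) * (1 + v\<^sup>2)"
    by (rule fps_stx_divide_mult[symmetric]) (simp add: power2_eq_square v(2))
  also have "(1 + v\<^sup>2) ^ (n - k) * (2 * v / (1 + v\<^sup>2) * (1 + v\<^sup>2)) ^ k = (1 + v\<^sup>2) ^ (n - k + k) * (2 * v / (1 + v\<^sup>2)) ^ k"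
    by (simp add: power_mult_distrib power_add mult_ac)
  finally show ?thesis
    using \<open>k \<le> n\<close> by (simp add: k_def)
qed

definition in_s :: "rat fps \<Rightarrow> fps_stx" where
  "in_s f = fps_const (fps_const f)"

definition in_t :: "rat fps \<Rightarrow> fps_stx" where
  "in_t f = fps_const (fps_embed f)"

text \<open>For each \<pi> the identity in s for \<pi> is multiplied by the identity in t for its
  inverse, which produces the 4 and the two squares. The sum over \<pi> then counts word
  pairs.\<close>

lemma lhs_coeff_eq:
  assumes n: "1 \<le> n"
  shows "((1 + var_s\<^sup>2) ^ n * (1 + var_t\<^sup>2) ^ n) / ((1 - var_s\<^sup>2) ^ (n - 1) * (1 - var_t\<^sup>2) ^ (n - 1))
      * P_udr_iudr n (2 * var_s / (1 + var_s\<^sup>2)) (2 * var_t / (1 + var_t\<^sup>2)) =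
    4 * (1 - var_s)\<^sup>2 * (1 - var_t)\<^sup>2 * fps_const (Abs_fps (\<lambda>b. Abs_fps (\<lambda>a. grid_gf a b $ n)))"
proof -
  define U V :: fps_stx where "U = (1 + var_s\<^sup>2) ^ n * (1 + var_t\<^sup>2) ^ n"
    and "V = (1 - var_s\<^sup>2) ^ (n - 1) * (1 - var_t\<^sup>2) ^ (n - 1)"
  have s0: "var_s $ 0 $ 0 $ 0 = 0" and t0: "var_t $ 0 $ 0 $ 0 = 0"
    by (simp_all add: var_s_def var_t_def)
  have V0: "V $ 0 $ 0 $ 0 \<noteq> 0"
    by (simp add: V_def fps_power_zeroth s0 t0)
  then have "V \<noteq> 0"
    by auto
  have term_eq: "U / V * ((2 * var_s / (1 + var_s\<^sup>2)) ^ udr n \<pi> * (2 * var_t / (1 + var_t\<^sup>2)) ^ iudr n \<pi>) =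
      4 * (1 - var_s)\<^sup>2 * (1 - var_t)\<^sup>2 * (in_s (label_gf n \<pi>) * in_t (label_gf n (inv \<pi>)))"
    if perm: "\<pi> permutes {1..n}" for \<pi>
  proof -
    define Q T where "Q = (2 * var_s / (1 + var_s\<^sup>2)) ^ udr n \<pi>" and "T = (2 * var_t / (1 + var_t\<^sup>2)) ^ iudr n \<pi>"
    have s: "2 * (1 - var_s)\<^sup>2 * (1 - var_s\<^sup>2) ^ (n - 1) * in_s (label_gf n \<pi>) = (1 + var_s\<^sup>2) ^ n * Q"
      unfolding Q_def by (rule label_gf_hom[OF _ _ _ _ _ perm n]) (simp_all add: in_s_def var_s_def)
    have t: "2 * (1 - var_t)\<^sup>2 * (1 - var_t\<^sup>2) ^ (n - 1) * in_t (label_gf n (inv \<pi>)) = (1 + var_t\<^sup>2) ^ n * T"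
      unfolding T_def iudr_def
      by (rule label_gf_hom[OF _ _ _ _ _ permutes_inv[OF perm] n])
        (simp_all add: in_t_def var_t_def fps_embed_add fps_embed_mult)
    \<comment> \<open>The comparison is made after multiplying by the nonzero \<open>V\<close>,
      which avoids manipulating quotients.\<close>
    have "U / V * (Q * T) * V = U * (Q * T)"
      using fps_stx_divide_mult[OF V0, of U] by (simp add: mult_ac)
    also have "\<dots> = ((1 + var_s\<^sup>2) ^ n * Q) * ((1 + var_t\<^sup>2) ^ n * T)"
      by (simp add: U_def mult_ac)
    also have "\<dots> = 4 * (1 - var_s)\<^sup>2 * (1 - var_t)\<^sup>2 * (in_s (label_gf n \<pi>) * in_t (label_gf n (inv \<pi>))) * V"
      unfolding s[symmetric] t[symmetric] V_def by (simp add: mult_ac)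
    finally show ?thesis
      using \<open>V \<noteq> 0\<close> by (simp add: Q_def T_def)
  qed
  \<comment> \<open>The coefficient of s^a t^b in a product of a series in s and a series in t is
    the product of the two coefficients.\<close>
  have "(\<Sum>\<pi> | \<pi> permutes {1..n}. in_s (label_gf n \<pi>) * in_t (label_gf n (inv \<pi>))) =
      fps_const (Abs_fps (\<lambda>b. Abs_fps (\<lambda>a. grid_gf a b $ n)))"
  proof -
    have "(\<Sum>\<pi> | \<pi> permutes {1..n}. fps_const (label_gf n \<pi>) * fps_embed (label_gf n (inv \<pi>))) =
        Abs_fps (\<lambda>b. Abs_fps (\<lambda>a. grid_gf a b $ n))"
      by (intro fps_ext) (simp add: fps_sum_nth label_gf_def grid_gf_def flip: sum_labellings_eq_card_word_pairs)
    then show ?thesis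
      by (simp add: in_s_def in_t_def flip: fps_const_sum')
  qed
  then show ?thesis
    unfolding P_udr_iudr_def U_def[symmetric] V_def[symmetric] sum_distrib_left
    by (simp add: term_eq flip: sum_distrib_left)
qed

text \<open>The geometric series, over a general ring so that it applies at the level of t as well
  as at that of s.\<close>

lemma Abs_fps_const_mult_one_minus_X: "Abs_fps (\<lambda>n. c) * (1 - fps_X) = fps_const (c :: 'a::comm_ring_1)"
proof (rule fps_ext)
  fix n show "(Abs_fps (\<lambda>n. c) * (1 - fps_X)) $ n = fps_const c $ n"
    by (cases n) (simp_all add: right_diff_distrib)
qed

theorem theorem5p1:
  fixes L :: "nat \<Rightarrow> fps_stx" and R :: "nat \<times> nat \<Rightarrow> fps_stx"
  defines "L \<equiv> (\<lambda>n.
      ((1 + var_s\<^sup>2) ^ n * (1 + var_t\<^sup>2) ^ n) / ((1 - var_s\<^sup>2) ^ (n - 1) * (1 - var_t\<^sup>2) ^ (n - 1))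
      * P_udr_iudr n (2 * var_s / (1 + var_s\<^sup>2)) (2 * var_t / (1 + var_t\<^sup>2)) * var_x ^ n)"
    and "R \<equiv> (\<lambda>(i, j).
      ((1 + var_x) / (1 - var_x)) ^ (2 * i * j)
      * (1 + var_s * ((1 + var_x) / (1 - var_x)) ^ j + var_t * ((1 + var_x) / (1 - var_x)) ^ i
         + var_s * var_t * ((1 + var_x) ^ (i + j) / (1 - var_x) ^ (i + j + 1)))
      * var_s ^ (2 * i) * var_t ^ (2 * j))"
  shows "formally_summable L {1..} \<and> formally_summable R UNIV \<and>
    1 / ((1 - var_s) * (1 - var_t))
      + 1 / (4 * (1 - var_s)\<^sup>2 * (1 - var_t)\<^sup>2) * formal_sum L {1..}
    = formal_sum R UNIV"
proof -
  \<comment> \<open>The coefficient of x^n on the right-hand side, as a series in s and t.\<close>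
  define B where "B = (\<lambda>n. Abs_fps (\<lambda>b. Abs_fps (\<lambda>a. grid_gf a b $ n)))"
  define K :: "rat fps fps" where "K = 4 * (1 - fps_const fps_X)\<^sup>2 * (1 - fps_X)\<^sup>2"
  have K: "4 * (1 - var_s)\<^sup>2 * (1 - var_t)\<^sup>2 = fps_const K"
  proof -
    have "fps_const (1 - f) = 1 - fps_const f" "fps_const (4 :: rat fps fps) = 4" for f :: "rat fps fps"
      by (simp_all flip: fps_const_sub numeral_fps_const)
    then show ?thesis
      by (simp add: K_def var_s_def var_t_def flip: fps_const_mult fps_const_power)
  qed
  \<comment> \<open>Each summand on the left is a single power of x times a series in s and t, so
    distinct summands never share a monomial.\<close>
  have L_nth: "L n $ m = (if m = n then K * B n else 0)" if "n \<in> {1..}" for n m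
  proof -
    have "L n = fps_const (K * B n) * fps_X ^ n"
      using that unfolding L_def by (subst lhs_coeff_eq) (simp_all add: K B_def var_x_def)
    then show ?thesis
      by (simp add: fps_X_power_mult_right_nth)
  qed
  have R_nth: "R p $ n $ j $ i = (if p = (i div 2, j div 2) then grid_gf i j $ n else 0)" for p n j i
    unfolding R_def case_prod_beta[of _ p] rhs_term_eq rhs_term_nth by (cases p) auto
  have "{n \<in> {1..}. L n $ m $ j $ i \<noteq> 0} \<subseteq> {m}" for m j i
    using L_nth by (auto split: if_splits)
  then have sumL: "formally_summable L {1..}"
    unfolding formally_summable_def by (meson finite.emptyI finite.insertI finite_subset)
  have "{p \<in> UNIV. R p $ n $ j $ i \<noteq> 0} \<subseteq> {(i div 2, j div 2)}" for n j i
    using R_nth by auto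
  then have sumR: "formally_summable R UNIV"
    unfolding formally_summable_def by (meson finite.emptyI finite.insertI finite_subset)
  have R_sum: "formal_sum R UNIV = Abs_fps B"
  proof (intro fps_ext)
    fix n j i
    have "{p. p \<in> UNIV \<and> R p $ n $ j $ i \<noteq> 0} = (if grid_gf i j $ n = 0 then {} else {(i div 2, j div 2)})"
      by (auto simp: R_nth)
    then show "formal_sum R UNIV $ n $ j $ i = Abs_fps B $ n $ j $ i"
      by (simp add: formal_sum_def B_def R_nth)
  qed
  \<comment> \<open>The sum starts at 1 and so lacks the coefficient of x^0, which the separate
    first term of the theorem supplies.\<close>
  have L_sum: "formal_sum L {1..} = fps_const K * (Abs_fps B - fps_const (B 0))"
  proof (intro fps_ext)
    fix n j i
    have "{m. m \<in> {1..} \<and> L m $ n $ j $ i \<noteq> 0} = (if 1 \<le> n \<and> (K * B n) $ j $ i \<noteq> 0 then {n} else {})"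
      using L_nth by (auto split: if_splits)
    then show "formal_sum L {1..} $ n $ j $ i = (fps_const K * (Abs_fps B - fps_const (B 0))) $ n $ j $ i"
      using L_nth[of n n] by (cases n) (simp_all add: formal_sum_def)
  qed
  have cancel: "1 / fps_const K * (fps_const K * (Abs_fps B - fps_const (B 0))) = Abs_fps B - fps_const (B 0)"
  proof -
    have "1 / fps_const K * fps_const K = 1"
      by (rule fps_stx_divide_mult) (simp add: K_def power2_eq_square)
    then show ?thesis
      by (simp flip: mult.assoc)
  qed
  \<comment> \<open>For length 0 there is exactly one word pair for every grid, including grids with
    a side of length 0, so \<open>B 0\<close> is the sum of all s^a t^b.\<close>
  have const_term: "1 / ((1 - var_s) * (1 - var_t)) = fps_const (B 0)"
  proof (rule divide_eq_stxI)
    have "grid_gf a b $ 0 = 1" for a b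
      by (simp add: grid_gf_def card_word_pairs rel_chains_0)
    then have B0: "B 0 = Abs_fps (\<lambda>b. Abs_fps (\<lambda>a. 1))"
      by (simp add: B_def)
    have "fps_const (B 0) * ((1 - var_s) * (1 - var_t)) =
        fps_const (B 0 * (1 - fps_X) * (1 - fps_const fps_X))"
      by (simp add: var_s_def var_t_def mult_ac flip: fps_const_mult fps_const_sub)
    also have "B 0 * (1 - fps_X) * (1 - fps_const fps_X) = fps_const (Abs_fps (\<lambda>a. 1) * (1 - fps_X))"
    proof -
      have "1 - fps_const fps_X = fps_const (1 - fps_X :: rat fps)"
        by (simp flip: fps_const_sub)
      then show ?thesis
        unfolding B0 Abs_fps_const_mult_one_minus_X by (simp add: Abs_fps_const_mult_one_minus_X)
    qed
    also have "\<dots> = 1"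
      unfolding Abs_fps_const_mult_one_minus_X by simp
    finally show "1 = fps_const (B 0) * ((1 - var_s) * (1 - var_t))"
      by simp
  qed (simp add: var_s_def var_t_def)
  show ?thesis
    unfolding K R_sum L_sum cancel const_term using sumL sumR by simp
qed

end
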